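(* Let $E$ be a finite directed graph and let $R$ be an associative unital ring. Then the Leavitt path algebra $L_R(E)$, equipped with its canonical $\mathbb{Z}$-gradation, is epsilon-strongly $\mathbb{Z}$-graded.
   Context: All rings are associative but not necessarily unital. Graphs. A directed graph $E=(E^0,E^1,r,s)$ consists of sets $E^0$ (vertices), $E^1$ (edges) and maps $r,s:E^1\to E^0$ (range, source). $E$ is finite if both $E^0$ and $E^1$ are finite sets. Leavitt path algebra. $L_R(E)$ is the (not necessarily unital) algebra with coefficients in $R$ generated by the sets $\{v\mid v\in E^0\}$, $\{f\mid f\in E^1\}$, $\{f^*\mid f\in E^1\}$, subject to: (1) $uv=\delta_{u,v}v$ for all $u,v\in E^0$; (2) $s(f)f=fr(f)=f$ and $r(f)f^*=f^*s(f)=f^*$ for all $f\in E^1$; (3) $f^*f'=\delta_{f,f'}r(f)$ for all $f,f'\in E^1$; (4) $\sum_{f\in E^1,\,s(f)=v}ff^*=v$ for every $v\in E^0$ for which $s^{-1}(v)$ is non-empty and finite. The elements of $R$ commute with the generators. Canonical $\mathbb{Z}$-gradation. It is the $\mathbb{Z}$-gradation on $L_R(E)$ determined by $\deg(v)=0$ for $v\in E^0$, $\deg(f)=1$ and $\deg(f^* )=-1$ for $f\in E^1$ (elements of $R$ have degree $0$). Graded rings. For a group $G$, a ring $S$ is $G$-graded if $S=\bigoplus_{g\in G}S_g$ with $S_g$ additive subgroups and $S_gS_h\subseteq S_{gh}$ for all $g,h\in G$; products of additive subgroups denote the set of finite sums of products. Unital bimodules. For rings $T,T'$, a $T$–$T'$-bimodule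 $M$ is unital if there are $t\in T$ and $t'\in T'$ such that $tm=m=mt'$ for all $m\in M$. Epsilon-strongly graded. A $G$-graded ring $S$ is epsilon-strongly $G$-graded if for each $g\in G$ the $S_gS_{g^{-1}}$–$S_{g^{-1}}S_g$-bimodule $S_g$ is unital. *)

theory Defs
  imports
    "HOL-Algebra.QuotRing"
    "HOL-Algebra.Ideal_Product"
    "HOL-Algebra.Elementary_Groups"
    "Graph_Theory.Digraph"
begin

section \<open>Rings without unit, bimodules, graded rings\<close>

text \<open>
  The record type of HOL-Algebra rings has a field for the unit; nothing below
  that concerns possibly non-unital rings looks at that field.
\<close>

locale nonunital_ring = abelian_group S for S (structure) +
  assumes mult_closed: "\<lbrakk>x \<in> carrier S; y \<in> carrier S\<rbrakk> \<Longrightarrow> x \<otimes> y \<in> carrier S"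
    and mult_assoc: "\<lbrakk>x \<in> carrier S; y \<in> carrier S; z \<in> carrier S\<rbrakk>
      \<Longrightarrow> (x \<otimes> y) \<otimes> z = x \<otimes> (y \<otimes> z)"
    and mult_distr_right: "\<lbrakk>x \<in> carrier S; y \<in> carrier S; z \<in> carrier S\<rbrakk>
      \<Longrightarrow> (x \<oplus> y) \<otimes> z = x \<otimes> z \<oplus> y \<otimes> z"
    and mult_distr_left: "\<lbrakk>x \<in> carrier S; y \<in> carrier S; z \<in> carrier S\<rbrakk>
      \<Longrightarrow> z \<otimes> (x \<oplus> y) = z \<otimes> x \<oplus> z \<otimes> y"

locale bimodule =
  T: nonunital_ring T + T': nonunital_ring T' + M: abelian_group M
  for T :: "('t, 'm) ring_scheme" and T' :: "('u, 'n) ring_scheme"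
    and M :: "('a, 'k) ring_scheme"
    and lact :: "'t \<Rightarrow> 'a \<Rightarrow> 'a" and ract :: "'a \<Rightarrow> 'u \<Rightarrow> 'a" +
  assumes lact_closed: "\<lbrakk>t \<in> carrier T; m \<in> carrier M\<rbrakk> \<Longrightarrow> lact t m \<in> carrier M"
    and ract_closed: "\<lbrakk>m \<in> carrier M; t' \<in> carrier T'\<rbrakk> \<Longrightarrow> ract m t' \<in> carrier M"
    and lact_add: "\<lbrakk>t \<in> carrier T; m \<in> carrier M; n \<in> carrier M\<rbrakk>
      \<Longrightarrow> lact t (m \<oplus>\<^bsub>M\<^esub> n) = lact t m \<oplus>\<^bsub>M\<^esub> lact t n"
    and add_lact: "\<lbrakk>s \<in> carrier T; t \<in> carrier T; m \<in> carrier M\<rbrakk>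
      \<Longrightarrow> lact (s \<oplus>\<^bsub>T\<^esub> t) m = lact s m \<oplus>\<^bsub>M\<^esub> lact t m"
    and lact_mult: "\<lbrakk>s \<in> carrier T; t \<in> carrier T; m \<in> carrier M\<rbrakk>
      \<Longrightarrow> lact (s \<otimes>\<^bsub>T\<^esub> t) m = lact s (lact t m)"
    and ract_add: "\<lbrakk>m \<in> carrier M; s' \<in> carrier T'; t' \<in> carrier T'\<rbrakk>
      \<Longrightarrow> ract m (s' \<oplus>\<^bsub>T'\<^esub> t') = ract m s' \<oplus>\<^bsub>M\<^esub> ract m t'"
    and add_ract: "\<lbrakk>m \<in> carrier M; n \<in> carrier M; t' \<in> carrier T'\<rbrakk>
      \<Longrightarrow> ract (m \<oplus>\<^bsub>M\<^esub> n) t' = ract m t' \<oplus>\<^bsub>M\<^esub> ract n t'"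
    and ract_mult: "\<lbrakk>m \<in> carrier M; s' \<in> carrier T'; t' \<in> carrier T'\<rbrakk>
      \<Longrightarrow> ract m (s' \<otimes>\<^bsub>T'\<^esub> t') = ract (ract m s') t'"
    and lact_ract: "\<lbrakk>t \<in> carrier T; m \<in> carrier M; t' \<in> carrier T'\<rbrakk>
      \<Longrightarrow> ract (lact t m) t' = lact t (ract m t')"

locale unital_bimodule = bimodule +
  assumes unital: "\<exists>t\<in>carrier T. \<exists>t'\<in>carrier T'. \<forall>m\<in>carrier M. lact t m = m \<and> ract m t' = m"

text \<open>
  The set of finite sums of products \<open>x \<otimes> y\<close> with \<open>x \<in> A\<close> and \<open>y \<in> B\<close> is
  \<^term>\<open>ideal_prod S A B\<close>: its inductive definition makes sense for arbitrary
  sets \<open>A\<close> and \<open>B\<close>. It only forms non-empty sums, which is no restriction when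
  \<open>A\<close> and \<open>B\<close> are additive subgroups, since then \<open>\<zero> = \<zero> \<otimes> \<zero>\<close>.
\<close>

locale graded_ring = G: group G + S: nonunital_ring S
  for G :: "('g, 'm) monoid_scheme" and S :: "('a, 'n) ring_scheme"
    and A :: "'g \<Rightarrow> 'a set" +
  assumes component_subgroup: "g \<in> carrier G \<Longrightarrow> additive_subgroup (A g) S"
    and direct_sum: "x \<in> carrier S \<Longrightarrow>
      \<exists>!f. f \<in> (\<Pi>\<^sub>E g\<in>carrier G. A g) \<and> finite {g \<in> carrier G. f g \<noteq> \<zero>\<^bsub>S\<^esub>} \<and>
        x = (\<Oplus>\<^bsub>S\<^esub>g\<in>{g \<in> carrier G. f g \<noteq> \<zero>\<^bsub>S\<^esub>}. f g)"
    and component_mult: "\<lbrakk>g \<in> carrier G; h \<in> carrier G\<rbrakk> \<Longrightarrow>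
      ideal_prod S (A g) (A h) \<subseteq> A (g \<otimes>\<^bsub>G\<^esub> h)"

locale epsilon_strongly_graded_ring = graded_ring +
  assumes unital_components: "g \<in> carrier G \<Longrightarrow>
    unital_bimodule
      (S\<lparr>carrier := ideal_prod S (A g) (A (inv\<^bsub>G\<^esub> g))\<rparr>)
      (S\<lparr>carrier := ideal_prod S (A (inv\<^bsub>G\<^esub> g)) (A g)\<rparr>)
      (S\<lparr>carrier := A g\<rparr>) (\<otimes>\<^bsub>S\<^esub>) (\<otimes>\<^bsub>S\<^esub>)"


section \<open>Free non-unital algebras\<close>

text \<open>
  An element of the free non-unital algebra on \<open>X\<close> with coefficients in \<open>R\<close> is a
  finitely supported function from the non-empty words over \<open>X\<close> to \<open>R\<close>, extended
  by zero to all lists; multiplication is convolution with respect to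
  concatenation, so coefficients commute with the generators (but not
  necessarily with each other). There is no unit, hence the arbitrary value of
  the field \<open>one\<close>.
\<close>

definition free_algebra :: "('r, 'm) ring_scheme \<Rightarrow> 'x set \<Rightarrow> ('x list \<Rightarrow> 'r) ring" where
  "free_algebra R X = \<lparr>
     carrier = {f. (\<forall>w. f w \<in> carrier R) \<and> finite {w. f w \<noteq> \<zero>\<^bsub>R\<^esub>} \<and>
                   (\<forall>w. f w \<noteq> \<zero>\<^bsub>R\<^esub> \<longrightarrow> w \<noteq> [] \<and> set w \<subseteq> X)},
     mult = (\<lambda>f g w. \<Oplus>\<^bsub>R\<^esub>i\<in>{..length w}. f (take i w) \<otimes>\<^bsub>R\<^esub> g (drop i w)),
     one = undefined,
     zero = (\<lambda>w. \<zero>\<^bsub>R\<^esub>),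
     add = (\<lambda>f g w. f w \<oplus>\<^bsub>R\<^esub> g w)\<rparr>"

definition word :: "('r, 'm) ring_scheme \<Rightarrow> 'x list \<Rightarrow> 'x list \<Rightarrow> 'r" where
  "word R u = (\<lambda>w. if w = u then \<one>\<^bsub>R\<^esub> else \<zero>\<^bsub>R\<^esub>)"

text \<open>
  In the absence of a unit, an ideal of an algebra has to be required explicitly
  to be closed under multiplication with coefficients.
\<close>

definition algebra_ideal ::
    "('r, 'm) ring_scheme \<Rightarrow> 'x set \<Rightarrow> ('x list \<Rightarrow> 'r) set \<Rightarrow> bool" where
  "algebra_ideal R X I \<longleftrightarrow> additive_subgroup I (free_algebra R X) \<and>
     (\<forall>p\<in>I. \<forall>q\<in>carrier (free_algebra R X).
        q \<otimes>\<^bsub>free_algebra R X\<^esub> p \<in> I \<and> p \<otimes>\<^bsub>free_algebra R X\<^esub> q \<in> I) \<and>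
     (\<forall>p\<in>I. \<forall>c\<in>carrier R. (\<lambda>w. c \<otimes>\<^bsub>R\<^esub> p w) \<in> I \<and> (\<lambda>w. p w \<otimes>\<^bsub>R\<^esub> c) \<in> I)"

definition generated_ideal ::
    "('r, 'm) ring_scheme \<Rightarrow> 'x set \<Rightarrow> ('x list \<Rightarrow> 'r) set \<Rightarrow> ('x list \<Rightarrow> 'r) set" where
  "generated_ideal R X P = \<Inter>{I. algebra_ideal R X I \<and> P \<subseteq> I}"


section \<open>Leavitt path algebras\<close>

text \<open>
  The source and range maps are \<^const>\<open>tail\<close> and \<^const>\<open>head\<close>;
  \<open>Ghost f\<close> stands for the generator \<open>f\<^sup>*\<close>.
\<close>

datatype ('v, 'e) generator = Vertex 'v | Edge 'e | Ghost 'e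

definition generators :: "('v, 'e) pre_digraph \<Rightarrow> ('v, 'e) generator set" where
  "generators E = Vertex ` verts E \<union> Edge ` arcs E \<union> Ghost ` arcs E"

abbreviation generator_algebra ::
    "('r, 'm) ring_scheme \<Rightarrow> ('v, 'e) pre_digraph \<Rightarrow> (('v, 'e) generator list \<Rightarrow> 'r) ring" where
  "generator_algebra R E \<equiv> free_algebra R (generators E)"

text \<open>A relation \<open>p = q\<close> is represented by the element \<open>p \<ominus> q\<close> of the free algebra.\<close>

inductive_set leavitt_relations ::
    "('r, 'm) ring_scheme \<Rightarrow> ('v, 'e) pre_digraph \<Rightarrow> (('v, 'e) generator list \<Rightarrow> 'r) set"
  for R :: "('r, 'm) ring_scheme" and E :: "('v, 'e) pre_digraph" where
  vertex_vertex: "\<lbrakk>u \<in> verts E; v \<in> verts E\<rbrakk> \<Longrightarrow>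
    word R [Vertex u, Vertex v]
      \<ominus>\<^bsub>generator_algebra R E\<^esub> (if u = v then word R [Vertex v] else \<zero>\<^bsub>generator_algebra R E\<^esub>)
    \<in> leavitt_relations R E"
| source_edge: "f \<in> arcs E \<Longrightarrow>
    word R [Vertex (tail E f), Edge f] \<ominus>\<^bsub>generator_algebra R E\<^esub> word R [Edge f]
    \<in> leavitt_relations R E"
| edge_range: "f \<in> arcs E \<Longrightarrow>
    word R [Edge f, Vertex (head E f)] \<ominus>\<^bsub>generator_algebra R E\<^esub> word R [Edge f]
    \<in> leavitt_relations R E"
| range_ghost: "f \<in> arcs E \<Longrightarrow>
    word R [Vertex (head E f), Ghost f] \<ominus>\<^bsub>generator_algebra R E\<^esub> word R [Ghost f]
    \<in> leavitt_relations R E"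
| ghost_source: "f \<in> arcs E \<Longrightarrow>
    word R [Ghost f, Vertex (tail E f)] \<ominus>\<^bsub>generator_algebra R E\<^esub> word R [Ghost f]
    \<in> leavitt_relations R E"
| ghost_edge: "\<lbrakk>f \<in> arcs E; f' \<in> arcs E\<rbrakk> \<Longrightarrow>
    word R [Ghost f, Edge f']
      \<ominus>\<^bsub>generator_algebra R E\<^esub>
        (if f = f' then word R [Vertex (head E f)] else \<zero>\<^bsub>generator_algebra R E\<^esub>)
    \<in> leavitt_relations R E"
| edge_ghost_sum: "\<lbrakk>v \<in> verts E; out_arcs E v \<noteq> {}; finite (out_arcs E v)\<rbrakk> \<Longrightarrow>
    (\<Oplus>\<^bsub>generator_algebra R E\<^esub>f\<in>out_arcs E v. word R [Edge f, Ghost f])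
      \<ominus>\<^bsub>generator_algebra R E\<^esub> word R [Vertex v]
    \<in> leavitt_relations R E"

definition leavitt_ideal ::
    "('r, 'm) ring_scheme \<Rightarrow> ('v, 'e) pre_digraph \<Rightarrow> (('v, 'e) generator list \<Rightarrow> 'r) set" where
  "leavitt_ideal R E = generated_ideal R (generators E) (leavitt_relations R E)"

definition leavitt_path_algebra ::
    "('r, 'm) ring_scheme \<Rightarrow> ('v, 'e) pre_digraph \<Rightarrow> (('v, 'e) generator list \<Rightarrow> 'r) set ring"
  where "leavitt_path_algebra R E = generator_algebra R E Quot leavitt_ideal R E"

fun generator_degree :: "('v, 'e) generator \<Rightarrow> int" where
  "generator_degree (Vertex v) = 0"
| "generator_degree (Edge f) = 1"
| "generator_degree (Ghost f) = - 1"

definition word_degree :: "('v, 'e) generator list \<Rightarrow> int" where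
  "word_degree w = sum_list (map generator_degree w)"

text \<open>
  The component of degree \<open>n\<close> consists of the classes of the \<open>R\<close>-linear
  combinations of words of degree \<open>n\<close>.
\<close>

definition leavitt_component ::
    "('r, 'm) ring_scheme \<Rightarrow> ('v, 'e) pre_digraph \<Rightarrow> int \<Rightarrow>
      (('v, 'e) generator list \<Rightarrow> 'r) set set" where
  "leavitt_component R E n =
     (\<lambda>p. leavitt_ideal R E +>\<^bsub>generator_algebra R E\<^esub> p) `
       {p \<in> carrier (generator_algebra R E). \<forall>w. p w \<noteq> \<zero>\<^bsub>R\<^esub> \<longrightarrow> word_degree w = n}"

end

theory Submission
  imports Defs "Graph_Theory.Arc_Walk" "HOL-Library.Sublist"
begin

text \<open>
  For a walk \<open>p\<close> with edges \<open>e\<^sub>1, \<dots>, e\<^sub>k\<close> write \<open>p\<close> also for the product \<open>e\<^sub>1 \<cdots> e\<^sub>k\<close> (the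
  start vertex if \<open>k = 0\<close>) and \<open>p\<^sup>*\<close> for \<open>e\<^sub>k\<^sup>* \<cdots> e\<^sub>1\<^sup>*\<close>. The relations rewrite every word
  of generators to \<open>0\<close> or to \<open>p q\<^sup>*\<close>, where \<open>p\<close> and \<open>q\<close> are walks ending at the same
  vertex and the degree is \<open>|p| - |q|\<close>. So the component of degree \<open>n\<close> is spanned by the
  elements \<open>c p q\<^sup>*\<close> with \<open>|p| - |q| = n\<close> and \<open>c\<close> in the coefficient ring. A walk \<open>p\<close> that
  occurs on the left of such an element is called leading of degree \<open>n\<close>; then \<open>q\<close> is leading of
  degree \<open>- n\<close>. It suffices to find, for every \<open>n\<close>, an element \<open>\<epsilon>\<^sub>n\<close> of \<open>S\<^sub>n S\<^sub>-\<^sub>n\<close>, where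
  \<open>S\<^sub>n\<close> is the component of degree \<open>n\<close>, with \<open>\<epsilon>\<^sub>n p = p\<close> and \<open>p\<^sup>* \<epsilon>\<^sub>n = p\<^sup>*\<close> for all leading
  walks \<open>p\<close> of degree \<open>n\<close>: then \<open>\<epsilon>\<^sub>n\<close> is a left unit and \<open>\<epsilon>\<^sub>-\<^sub>n\<close> a right unit for \<open>S\<^sub>n\<close>.

  For a leading walk \<open>p\<close> the idempotent \<open>p p\<^sup>* = (p q\<^sup>*) (q p\<^sup>*)\<close> lies in \<open>S\<^sub>n S\<^sub>-\<^sub>n\<close>. Let \<open>\<epsilon>\<^sub>n\<close> be
  the sum of the \<open>p p\<^sup>*\<close> over those leading walks of degree \<open>n\<close> that have no proper leading prefix.
  Every leading walk \<open>p\<close> has exactly one such minimal prefix \<open>p\<^sub>0\<close>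
  (\<open>minimal_walk_prefix\<close>), and every other minimal walk \<open>p\<^sub>1\<close> is incomparable to \<open>p\<close>, whence
  \<open>p\<^sub>1\<^sup>* p = 0\<close> (\<open>ghosts_edges_parallel\<close>) while \<open>p\<^sub>0 p\<^sub>0\<^sup>* p = p\<close>. So \<open>\<epsilon>\<^sub>n p = p\<close>, and
  similarly \<open>p\<^sup>* \<epsilon>\<^sub>n = p\<^sup>*\<close>.

  Finiteness of the graph makes the sum finite (\<open>finite_minimal_walks\<close>). The set of end
  vertices of walks of length \<open>k\<close> decreases with \<open>k\<close>, hence is constant from some \<open>N\<close> on; so a
  vertex that ends some walk of length at least \<open>N\<close> ends walks of every length, every walk that is
  long compared with \<open>N\<close> and \<open>n\<close> is leading of degree \<open>n\<close>, and minimal walks have bounded length.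

  That the components form a gradation at all is a general fact about algebras presented by
  homogeneous relations (\<open>quotient_graded_ring\<close>): the ideal generated by homogeneous elements
  contains the homogeneous parts of its elements (\<open>part_in_ideal\<close>), so that decompositions into
  homogeneous parts descend uniquely to the quotient.
\<close>

section \<open>Additive subgroups and rings without unit\<close>

lemma (in abelian_monoid) finsum_one_nonzero:
  assumes "finite A" "a \<in> A" "f a \<in> carrier G" "\<And>b. \<lbrakk>b \<in> A; b \<noteq> a\<rbrakk> \<Longrightarrow> f b = \<zero>"
  shows "finsum G f A = f a"
proof -
  have "finsum G f A = (\<Oplus>b\<in>A. if a = b then f a else \<zero>)"
    using assms by (intro finsum_cong') auto
  also have "\<dots> = f a"
    using finsum_singleton[OF assms(2,1), of "\<lambda>_. f a"] assms(3) by simp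
  finally show ?thesis .
qed

lemma (in abelian_group) additive_subgroup_criterion:
  assumes "H \<subseteq> carrier G" "\<zero> \<in> H"
    and "\<And>x y. \<lbrakk>x \<in> H; y \<in> H\<rbrakk> \<Longrightarrow> x \<oplus> y \<in> H"
    and "\<And>x. x \<in> H \<Longrightarrow> \<ominus> x \<in> H"
  shows "additive_subgroup H G"
  using assms by (intro additive_subgroup.intro) (auto intro!: add.subgroupI)

lemma (in abelian_group) finsum_in_additive_subgroup:
  assumes "additive_subgroup H G" "f \<in> A \<rightarrow> H"
  shows "finsum G f A \<in> H"
proof -
  interpret H: additive_subgroup H G by fact
  show ?thesis
    using assms(2)
  proof (induction A rule: infinite_finite_induct)
    case (insert a A)
    then have "f \<in> A \<rightarrow> carrier G" "f a \<in> carrier G"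
      using H.a_subset by blast+
    with insert show ?case
      by (simp add: Pi_iff)
  qed simp_all
qed

lemma (in abelian_group) abelian_group_restrict:
  assumes "additive_subgroup H G"
  shows "abelian_group (G\<lparr>carrier := H\<rparr>)"
proof -
  interpret H: additive_subgroup H G by fact
  have "\<exists>y\<in>H. y \<oplus> x = \<zero>" if "x \<in> H" for x
    using that by (intro bexI[of _ "\<ominus> x"]) (simp_all add: l_neg)
  then show ?thesis
    by (intro abelian_groupI) (simp_all add: a_ac)
qed

context nonunital_ring
begin

lemma zero_mult [simp]:
  assumes "x \<in> carrier S"
  shows "\<zero> \<otimes> x = \<zero>"
proof -
  have "\<zero> \<otimes> x \<oplus> \<zero> \<otimes> x = \<zero> \<otimes> x"
    using assms mult_distr_right[of \<zero> \<zero> x] by simp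
  then show ?thesis
    using assms by (simp add: mult_closed)
qed

lemma mult_zero [simp]:
  assumes "x \<in> carrier S"
  shows "x \<otimes> \<zero> = \<zero>"
proof -
  have "x \<otimes> \<zero> \<oplus> x \<otimes> \<zero> = x \<otimes> \<zero>"
    using assms mult_distr_left[of \<zero> \<zero> x] by simp
  then show ?thesis
    using assms by (simp add: mult_closed)
qed

lemma minus_mult:
  assumes "x \<in> carrier S" "y \<in> carrier S"
  shows "(\<ominus> x) \<otimes> y = \<ominus> (x \<otimes> y)"
  using assms mult_distr_right[of "\<ominus> x" x y]
  by (intro minus_equality[symmetric]) (simp_all add: mult_closed l_neg)

lemma mult_minus:
  assumes "x \<in> carrier S" "y \<in> carrier S"
  shows "x \<otimes> (\<ominus> y) = \<ominus> (x \<otimes> y)"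
  using assms mult_distr_left[of "\<ominus> y" y x]
  by (intro minus_equality[symmetric]) (simp_all add: mult_closed l_neg)

lemma finsum_mult:
  assumes "f \<in> A \<rightarrow> carrier S" "y \<in> carrier S"
  shows "finsum S f A \<otimes> y = (\<Oplus>i\<in>A. f i \<otimes> y)"
  using assms
  by (induction A rule: infinite_finite_induct) (auto simp: Pi_iff mult_closed mult_distr_right)

lemma mult_finsum:
  assumes "f \<in> A \<rightarrow> carrier S" "y \<in> carrier S"
  shows "y \<otimes> finsum S f A = (\<Oplus>i\<in>A. y \<otimes> f i)"
  using assms
  by (induction A rule: infinite_finite_induct) (auto simp: Pi_iff mult_closed mult_distr_left)

lemma nonunital_ring_restrict:
  assumes "additive_subgroup H S" "\<And>x y. \<lbrakk>x \<in> H; y \<in> H\<rbrakk> \<Longrightarrow> x \<otimes> y \<in> H"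
  shows "nonunital_ring (S\<lparr>carrier := H\<rparr>)"
proof -
  interpret H: additive_subgroup H S by fact
  show ?thesis
    using assms abelian_group_restrict[OF assms(1)]
    by (intro nonunital_ring.intro nonunital_ring_axioms.intro)
      (simp_all add: mult_assoc mult_distr_left mult_distr_right)
qed

lemma ideal_prod_additive_subgroup:
  assumes "additive_subgroup A S" "additive_subgroup B S"
  shows "additive_subgroup (ideal_prod S A B) S"
proof -
  interpret A: additive_subgroup A S by fact
  interpret B: additive_subgroup B S by fact
  have closed: "x \<in> carrier S" if "x \<in> ideal_prod S A B" for x
    using that by induction (auto intro: mult_closed)
  show ?thesis
  proof (rule additive_subgroup_criterion)
    show "ideal_prod S A B \<subseteq> carrier S"
      using closed by blast
    show "\<zero> \<in> ideal_prod S A B"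
      using ideal_prod.prod[of \<zero> A \<zero> B S] by simp
    fix x assume "x \<in> ideal_prod S A B"
    then show "\<ominus> x \<in> ideal_prod S A B"
    proof induction
      case (prod a b)
      then have "\<ominus> (a \<otimes> b) = (\<ominus> a) \<otimes> b"
        by (simp add: minus_mult)
      then show ?case
        using prod by (simp add: ideal_prod.prod)
    next
      case (sum x y)
      then show ?case
        by (simp add: closed minus_add ideal_prod.sum)
    qed
  qed (rule ideal_prod.sum)
qed

end


section \<open>Quotients of rings without unit\<close>

locale nonunital_ideal = nonunital_ring S + additive_subgroup I S for I and S (structure) +
  assumes mult_ideal_closed: "\<lbrakk>x \<in> carrier S; i \<in> I\<rbrakk> \<Longrightarrow> x \<otimes> i \<in> I"
    and ideal_mult_closed: "\<lbrakk>i \<in> I; x \<in> carrier S\<rbrakk> \<Longrightarrow> i \<otimes> x \<in> I"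
begin

sublocale abelian_subgroup I S
  by (rule abelian_subgroupI3) unfold_locales

lemma coset_eq_iff:
  assumes "x \<in> carrier S" "y \<in> carrier S"
  shows "I +> x = I +> y \<longleftrightarrow> x \<ominus> y \<in> I"
proof -
  have "I +> x = I +> y \<longleftrightarrow> x \<in> I +> y"
    using assms a_repr_independence' a_rcos_self by metis
  then show ?thesis
    using assms a_rcos_module by (simp add: a_minus_def)
qed

lemma coset_eq_zero_iff:
  assumes "x \<in> carrier S"
  shows "I +> x = I \<longleftrightarrow> x \<in> I"
  using assms a_rcos_const a_rcos_self by blast

lemma quotient_carrier: "carrier (S Quot I) = (+>) I ` carrier S"
  by (auto simp: FactRing_def A_RCOSETS_def')

lemma quotient_zero: "\<zero>\<^bsub>S Quot I\<^esub> = I"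
  by (simp add: FactRing_def)

lemma coset_closed [simp]: "x \<in> carrier S \<Longrightarrow> I +> x \<in> carrier (S Quot I)"
  by (simp add: quotient_carrier)

lemma coset_add:
  assumes "x \<in> carrier S" "y \<in> carrier S"
  shows "(I +> x) \<oplus>\<^bsub>S Quot I\<^esub> (I +> y) = I +> (x \<oplus> y)"
  using assms by (simp add: FactRing_def a_rcos_sum)

text \<open>
  The product of cosets is defined as a union over all representatives. As \<open>I\<close> absorbs products
  from both sides, \<open>a b - x y = (a - x) b + x (b - y)\<close> lies in \<open>I\<close>, so all members of that union
  are the same coset.
\<close>

lemma coset_mult:
  assumes "x \<in> carrier S" "y \<in> carrier S"
  shows "(I +> x) \<otimes>\<^bsub>S Quot I\<^esub> (I +> y) = I +> (x \<otimes> y)"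
proof -
  have "I +> (a \<otimes> b) = I +> (x \<otimes> y)" if ab: "a \<in> I +> x" "b \<in> I +> y" for a b
  proof -
    have carr: "a \<in> carrier S" "b \<in> carrier S"
      using assms ab a_elemrcos_carrier by blast+
    have "a \<ominus> x \<in> I" "b \<ominus> y \<in> I"
      using assms ab carr by (simp_all add: a_rcos_module a_minus_def)
    then have "(a \<ominus> x) \<otimes> b \<oplus> x \<otimes> (b \<ominus> y) \<in> I"
      using assms carr by (simp add: mult_ideal_closed ideal_mult_closed)
    also have "(a \<ominus> x) \<otimes> b \<oplus> x \<otimes> (b \<ominus> y) = a \<otimes> b \<ominus> x \<otimes> y"
      using assms carr
      by (simp add: a_minus_def mult_distr_left mult_distr_right mult_closed minus_mult
          mult_minus a_assoc r_neg1)
    finally show ?thesis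
      using assms carr by (simp add: coset_eq_iff mult_closed)
  qed
  then have "(\<Union>a\<in>I +> x. \<Union>b\<in>I +> y. I +> a \<otimes> b) = (\<Union>a\<in>I +> x. \<Union>b\<in>I +> y. I +> x \<otimes> y)"
    by (intro SUP_cong) simp_all
  moreover have "I +> x \<noteq> {}" "I +> y \<noteq> {}"
    using assms a_rcos_self by blast+
  ultimately show ?thesis
    by (simp add: FactRing_def rcoset_mult_def)
qed

lemma quotient_nonunital_ring: "nonunital_ring (S Quot I)"
proof -
  have "abelian_group (S Quot I)"
    using a_factorgroup_is_comm_group
    by (intro comm_group_abelian_groupI) (simp add: FactRing_def A_FactGroup_def')
  moreover have "nonunital_ring_axioms (S Quot I)"
    unfolding nonunital_ring_axioms_def quotient_carrier ball_simps
    by (intro conjI allI impI; elim imageE)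
      (simp_all add: coset_add coset_mult mult_closed mult_assoc mult_distr_left mult_distr_right)
  ultimately show ?thesis
    by (rule nonunital_ring.intro)
qed

lemma coset_finsum:
  assumes "f \<in> A \<rightarrow> carrier S"
  shows "(\<Oplus>\<^bsub>S Quot I\<^esub>i\<in>A. I +> f i) = I +> finsum S f A"
proof -
  interpret Q: nonunital_ring "S Quot I"
    by (rule quotient_nonunital_ring)
  have Q0: "finsum (S Quot I) g {} = I" "infinite B \<Longrightarrow> finsum (S Quot I) g B = I"
    for g :: "'b \<Rightarrow> 'a set" and B
    using Q.finsum_empty Q.finsum_infinite by (simp_all add: quotient_zero)
  show ?thesis
    using assms
  proof (induction A rule: infinite_finite_induct)
    case (insert a A)
    then have f: "f \<in> A \<rightarrow> carrier S" "f a \<in> carrier S"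
      by auto
    then have "(\<lambda>i. I +> f i) \<in> A \<rightarrow> carrier (S Quot I)"
      by (simp add: Pi_iff)
    with insert f show ?case
      by (simp add: coset_add)
  qed (use Q0 a_rcos_const[OF zero_closed] in simp_all)
qed

lemma coset_minus:
  assumes "x \<in> carrier S"
  shows "\<ominus>\<^bsub>S Quot I\<^esub> (I +> x) = I +> (\<ominus> x)"
proof -
  interpret Q: nonunital_ring "S Quot I"
    by (rule quotient_nonunital_ring)
  show ?thesis
    using assms by (intro Q.minus_equality) (simp_all add: coset_add l_neg a_rcos_const quotient_zero)
qed

lemma coset_image_additive_subgroup:
  assumes "additive_subgroup H S"
  shows "additive_subgroup ((+>) I ` H) (S Quot I)"
proof -
  interpret Q: nonunital_ring "S Quot I"
    by (rule quotient_nonunital_ring)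
  interpret H: additive_subgroup H S by fact
  show ?thesis
  proof (rule Q.additive_subgroup_criterion)
    show "\<zero>\<^bsub>S Quot I\<^esub> \<in> (+>) I ` H"
      using a_rcos_const[OF zero_closed] H.zero_closed by (force simp: quotient_zero)
  qed (auto simp: quotient_carrier coset_add coset_minus)
qed

end


section \<open>A criterion for epsilon-strong gradings\<close>

text \<open>
  The bimodule axioms hold in every graded ring, because \<open>S\<^sub>g S\<^sub>h\<close> with \<open>h\<close> inverse to \<open>g\<close>
  consists of elements of neutral degree, which map each component and each product of components
  into itself. So only the two units have to be exhibited.
\<close>

lemma (in graded_ring) epsilon_strongly_gradedI:
  assumes left_unit: "\<And>g. g \<in> carrier G \<Longrightarrow>
      \<exists>t \<in> ideal_prod S (A g) (A (inv\<^bsub>G\<^esub> g)). \<forall>m\<in>A g. t \<otimes>\<^bsub>S\<^esub> m = m"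
    and right_unit: "\<And>g. g \<in> carrier G \<Longrightarrow>
      \<exists>t \<in> ideal_prod S (A (inv\<^bsub>G\<^esub> g)) (A g). \<forall>m\<in>A g. m \<otimes>\<^bsub>S\<^esub> t = m"
  shows "epsilon_strongly_graded_ring G S A"
proof (intro epsilon_strongly_graded_ring.intro epsilon_strongly_graded_ring_axioms.intro)
  show "graded_ring G S A" by unfold_locales
next
  fix g assume g: "g \<in> carrier G"
  let ?h = "inv\<^bsub>G\<^esub> g"
  let ?T = "ideal_prod S (A g) (A ?h)" and ?T' = "ideal_prod S (A ?h) (A g)"
  have h: "?h \<in> carrier G"
    using g by simp
  interpret Ag: additive_subgroup "A g" S
    using g by (rule component_subgroup)
  have T: "additive_subgroup ?T S" and T': "additive_subgroup ?T' S"
    using g h by (simp_all add: S.ideal_prod_additive_subgroup component_subgroup)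
  interpret T: additive_subgroup ?T S by (rule T)
  interpret T': additive_subgroup ?T' S by (rule T')
  have deg: "x \<otimes>\<^bsub>S\<^esub> y \<in> A (a \<otimes>\<^bsub>G\<^esub> b)"
    if "a \<in> carrier G" "b \<in> carrier G" "x \<in> A a" "y \<in> A b" for a b x y
    using component_mult[OF that(1,2)] ideal_prod.prod[OF that(3,4), of S] by blast
  have T_deg: "x \<in> A \<one>\<^bsub>G\<^esub>" if "x \<in> ?T" for x
    using component_mult[OF g h] that g by auto
  have T'_deg: "x \<in> A \<one>\<^bsub>G\<^esub>" if "x \<in> ?T'" for x
    using component_mult[OF h g] that g by auto
  have TA: "x \<otimes>\<^bsub>S\<^esub> m \<in> A g" if "x \<in> ?T" "m \<in> A g" for x m
    using deg[OF _ g T_deg[OF that(1)] that(2)] g by simp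
  have AT: "m \<otimes>\<^bsub>S\<^esub> x \<in> A g" if "m \<in> A g" "x \<in> ?T'" for x m
    using deg[OF g _ that(1) T'_deg[OF that(2)]] g by simp
  have closed: "x \<otimes>\<^bsub>S\<^esub> y \<in> ideal_prod S (A a) (A b)"
    if "a \<in> carrier G" "b \<in> carrier G" "x \<in> A \<one>\<^bsub>G\<^esub>" "y \<in> ideal_prod S (A a) (A b)" for a b x y
  proof -
    interpret Aa: additive_subgroup "A a" S using that(1) by (rule component_subgroup)
    interpret Ab: additive_subgroup "A b" S using that(2) by (rule component_subgroup)
    interpret A1: additive_subgroup "A \<one>\<^bsub>G\<^esub>" S by (rule component_subgroup) simp
    interpret AB: additive_subgroup "ideal_prod S (A a) (A b)" S
      using that by (simp add: S.ideal_prod_additive_subgroup component_subgroup)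
    show ?thesis
      using that(4)
    proof induction
      case (prod y z)
      then have "x \<otimes>\<^bsub>S\<^esub> (y \<otimes>\<^bsub>S\<^esub> z) = (x \<otimes>\<^bsub>S\<^esub> y) \<otimes>\<^bsub>S\<^esub> z"
        using that(3) by (simp add: S.mult_assoc)
      moreover have "x \<otimes>\<^bsub>S\<^esub> y \<in> A a"
        using deg[OF _ that(1) that(3) prod(1)] that(1) by simp
      ultimately show ?case
        using prod by (simp add: ideal_prod.prod)
    next
      case (sum y z)
      then show ?case
        using that(3) by (simp add: S.mult_distr_left ideal_prod.sum)
    qed
  qed
  obtain t t' where "t \<in> ?T" "\<forall>m\<in>A g. t \<otimes>\<^bsub>S\<^esub> m = m" "t' \<in> ?T'" "\<forall>m\<in>A g. m \<otimes>\<^bsub>S\<^esub> t' = m"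
    using left_unit[OF g] right_unit[OF g] by blast
  moreover have "nonunital_ring (S\<lparr>carrier := ?T\<rparr>)" "nonunital_ring (S\<lparr>carrier := ?T'\<rparr>)"
    using g h closed T_deg T'_deg T T' by (auto intro!: S.nonunital_ring_restrict)
  moreover have "abelian_group (S\<lparr>carrier := A g\<rparr>)"
    using g component_subgroup by (intro S.abelian_group_restrict)
  ultimately show "unital_bimodule (S\<lparr>carrier := ?T\<rparr>) (S\<lparr>carrier := ?T'\<rparr>)
      (S\<lparr>carrier := A g\<rparr>) (\<otimes>\<^bsub>S\<^esub>) (\<otimes>\<^bsub>S\<^esub>)"
    by (intro unital_bimodule.intro bimodule.intro bimodule_axioms.intro
        unital_bimodule_axioms.intro)
      (auto simp: TA AT S.mult_assoc S.mult_distr_left S.mult_distr_right)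
qed


section \<open>Convolution of functions on words\<close>

context ring
begin

definition convolution :: "('x list \<Rightarrow> 'a) \<Rightarrow> ('x list \<Rightarrow> 'a) \<Rightarrow> 'x list \<Rightarrow> 'a" where
  "convolution f g w = (\<Oplus>i\<in>{..length w}. f (take i w) \<otimes> g (drop i w))"

lemma convolution_closed:
  assumes "\<And>w. f w \<in> carrier R" "\<And>w. g w \<in> carrier R"
  shows "convolution f g w \<in> carrier R"
  using assms by (simp add: convolution_def Pi_iff)

lemma convolution_Nil:
  assumes "\<And>w. f w \<in> carrier R" "\<And>w. g w \<in> carrier R"
  shows "convolution f g [] = f [] \<otimes> g []"
  using assms by (simp add: convolution_def)

text \<open>
  Splitting off the empty prefix turns convolution into a recursion on the word, which reduces
  associativity to an induction with linearity, in place of an exchange of double sums.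
\<close>

lemma convolution_Cons:
  assumes "\<And>w. f w \<in> carrier R" "\<And>w. g w \<in> carrier R"
  shows "convolution f g (x # w) = f [] \<otimes> g (x # w) \<oplus> convolution (\<lambda>u. f (x # u)) g w"
proof -
  have "convolution f g (x # w) = (\<Oplus>i\<in>{..Suc (length w)}. f (take i (x # w)) \<otimes> g (drop i (x # w)))"
    by (simp only: convolution_def list.size add_0_right add_Suc_right)
  also have "\<dots> = (\<Oplus>i\<in>{..length w}. f (x # take i w) \<otimes> g (drop i w)) \<oplus> f [] \<otimes> g (x # w)"
    by (subst finsum_Suc2) (simp_all add: assms)
  finally show ?thesis
    by (simp add: convolution_def a_comm Pi_iff assms)
qed

lemma convolution_add_left:
  assumes "\<And>w. f w \<in> carrier R" "\<And>w. f' w \<in> carrier R" "\<And>w. g w \<in> carrier R"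
  shows "convolution (\<lambda>u. f u \<oplus> f' u) g w = convolution f g w \<oplus> convolution f' g w"
  using assms by (simp add: convolution_def l_distr finsum_addf Pi_iff)

lemma convolution_add_right:
  assumes "\<And>w. f w \<in> carrier R" "\<And>w. g w \<in> carrier R" "\<And>w. g' w \<in> carrier R"
  shows "convolution f (\<lambda>u. g u \<oplus> g' u) w = convolution f g w \<oplus> convolution f g' w"
  using assms by (simp add: convolution_def r_distr finsum_addf Pi_iff)

lemma convolution_scale_left:
  assumes "\<And>w. f w \<in> carrier R" "\<And>w. g w \<in> carrier R" "c \<in> carrier R"
  shows "convolution (\<lambda>u. c \<otimes> f u) g w = c \<otimes> convolution f g w"
  using assms by (simp add: convolution_def finsum_rdistr m_assoc Pi_iff)

lemma convolution_assoc:
  assumes "\<And>w. f w \<in> carrier R" "\<And>w. g w \<in> carrier R" "\<And>w. h w \<in> carrier R"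
  shows "convolution (convolution f g) h w = convolution f (convolution g h) w"
  using assms(1,2)
proof (induction w arbitrary: f g)
  case Nil
  then show ?case
    using assms(3) by (simp add: convolution_Nil convolution_closed m_assoc)
next
  case (Cons x w)
  note closed = Cons.prems assms(3) convolution_closed
  have "convolution (convolution f g) h (x # w) =
      f [] \<otimes> g [] \<otimes> h (x # w) \<oplus> convolution (\<lambda>u. f [] \<otimes> g (x # u) \<oplus> convolution (\<lambda>u. f (x # u)) g u) h w"
    by (simp add: convolution_Cons convolution_Nil closed)
  also have "\<dots> = f [] \<otimes> g [] \<otimes> h (x # w) \<oplus>
      (f [] \<otimes> convolution (\<lambda>u. g (x # u)) h w \<oplus> convolution (\<lambda>u. f (x # u)) (convolution g h) w)"
    by (simp add: convolution_add_left convolution_scale_left Cons.IH closed)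
  also have "\<dots> = convolution f (convolution g h) (x # w)"
    by (simp add: convolution_Cons closed m_assoc r_distr a_assoc)
  finally show ?case .
qed

lemma convolution_support:
  assumes "\<And>w. f w \<in> carrier R" "\<And>w. g w \<in> carrier R" "convolution f g w \<noteq> \<zero>"
  obtains u v where "w = u @ v" "f u \<noteq> \<zero>" "g v \<noteq> \<zero>"
proof -
  have "\<exists>i\<in>{..length w}. f (take i w) \<otimes> g (drop i w) \<noteq> \<zero>"
  proof (rule ccontr)
    assume "\<not> ?thesis"
    then have "convolution f g w = \<zero>"
      unfolding convolution_def by (intro add.finprod_one_eqI) simp
    with assms(3) show False ..
  qed
  then obtain i where "f (take i w) \<noteq> \<zero>" "g (drop i w) \<noteq> \<zero>"
    using assms(1,2) l_null r_null by metis
  then show thesis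
    using that[of "take i w" "drop i w"] by simp
qed

definition monomial :: "'a \<Rightarrow> 'x list \<Rightarrow> 'x list \<Rightarrow> 'a" where
  "monomial c u = (\<lambda>w. if w = u then c else \<zero>)"

lemma word_eq_monomial: "word R u = monomial \<one> u"
  by (simp add: word_def monomial_def)

lemma convolution_monomial:
  assumes "c \<in> carrier R" "d \<in> carrier R"
  shows "convolution (monomial c u) (monomial d v) = monomial (c \<otimes> d) (u @ v)"
proof
  fix w
  have "convolution (monomial c u) (monomial d v) w =
      (\<Oplus>i\<in>{..length w}. if i = length u then monomial (c \<otimes> d) (u @ v) w else \<zero>)"
    unfolding convolution_def
  proof (rule finsum_cong')
    fix i assume "i \<in> {..length w}"
    then have "take i w = u \<and> drop i w = v \<longleftrightarrow> i = length u \<and> w = u @ v"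
      by auto
    then show "monomial c u (take i w) \<otimes> monomial d v (drop i w) =
        (if i = length u then monomial (c \<otimes> d) (u @ v) w else \<zero>)"
      using assms by (cases "take i w = u"; cases "drop i w = v"; simp add: monomial_def)
  qed (use assms in \<open>simp_all add: monomial_def\<close>)
  also have "\<dots> = monomial (c \<otimes> d) (u @ v) w"
  proof (cases "length u \<le> length w")
    case True
    then show ?thesis
      using assms add.finprod_singleton_swap[of "length u" "{..length w}" "\<lambda>_. monomial (c \<otimes> d) (u @ v) w"]
      by (simp add: monomial_def)
  next
    case False
    then have "w \<noteq> u @ v" by auto
    then have "monomial (c \<otimes> d) (u @ v) w = \<zero>"
      by (simp add: monomial_def)
    then show ?thesis
      by (simp add: add.finprod_one_eqI)
  qed
  finally show "convolution (monomial c u) (monomial d v) w = monomial (c \<otimes> d) (u @ v) w" .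
qed

end


section \<open>Free non-unital algebras are rings without unit\<close>

locale free_nonunital_algebra = ring R for R (structure) +
  fixes X :: "'x set"
begin

abbreviation "F \<equiv> free_algebra R X"

lemma free_algebra_add: "(f \<oplus>\<^bsub>F\<^esub> g) w = f w \<oplus> g w"
  by (simp add: free_algebra_def)

lemma free_algebra_zero: "\<zero>\<^bsub>F\<^esub> w = \<zero>"
  by (simp add: free_algebra_def)

lemma free_algebra_mult: "f \<otimes>\<^bsub>F\<^esub> g = convolution f g"
  by (simp add: free_algebra_def convolution_def fun_eq_iff)

lemma free_algebra_carrier_iff:
  "f \<in> carrier F \<longleftrightarrow> (\<forall>w. f w \<in> carrier R) \<and> finite {w. f w \<noteq> \<zero>} \<and>
    (\<forall>w. f w \<noteq> \<zero> \<longrightarrow> w \<noteq> [] \<and> set w \<subseteq> X)"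
  unfolding free_algebra_def partial_object.simps mem_Collect_eq ..

lemma coefficient_closed [simp]: "f \<in> carrier F \<Longrightarrow> f w \<in> carrier R"
  and finite_support: "f \<in> carrier F \<Longrightarrow> finite {w. f w \<noteq> \<zero>}"
  and supportD: "\<lbrakk>f \<in> carrier F; f w \<noteq> \<zero>\<rbrakk> \<Longrightarrow> w \<noteq> [] \<and> set w \<subseteq> X"
  unfolding free_algebra_carrier_iff by blast+

lemma free_algebra_carrierI:
  assumes "\<And>w. f w \<in> carrier R" "\<And>w. f w \<noteq> \<zero> \<Longrightarrow> w \<noteq> [] \<and> set w \<subseteq> X"
    and "finite A" "\<And>w. f w \<noteq> \<zero> \<Longrightarrow> w \<in> A"
  shows "f \<in> carrier F"
proof -
  have "finite {w. f w \<noteq> \<zero>}"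
    using assms(3) by (rule rev_finite_subset) (use assms(4) in auto)
  with assms(1,2) show ?thesis
    unfolding free_algebra_carrier_iff by blast
qed

lemma carrier_mono_support:
  assumes "f \<in> carrier F" "\<And>w. g w \<in> carrier R" "\<And>w. g w \<noteq> \<zero> \<Longrightarrow> f w \<noteq> \<zero>"
  shows "g \<in> carrier F"
  by (rule free_algebra_carrierI[OF _ _ finite_support[OF assms(1)]])
    (use assms supportD in auto)

lemma free_algebra_abelian_group: "abelian_group F"
proof (rule abelian_groupI)
  show "f \<oplus>\<^bsub>F\<^esub> g \<in> carrier F" if "f \<in> carrier F" "g \<in> carrier F" for f g
    using that
  proof (intro free_algebra_carrierI)
    have nonzero: "f w \<noteq> \<zero> \<or> g w \<noteq> \<zero>" if "(f \<oplus>\<^bsub>F\<^esub> g) w \<noteq> \<zero>" for w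
      using that by (auto simp: free_algebra_add)
    then show "w \<noteq> [] \<and> set w \<subseteq> X" if "(f \<oplus>\<^bsub>F\<^esub> g) w \<noteq> \<zero>" for w
      using that \<open>f \<in> carrier F\<close> \<open>g \<in> carrier F\<close> supportD by blast
    show "w \<in> {w. f w \<noteq> \<zero>} \<union> {w. g w \<noteq> \<zero>}" if "(f \<oplus>\<^bsub>F\<^esub> g) w \<noteq> \<zero>" for w
      using nonzero[OF that] by simp
  qed (use that in \<open>simp_all add: free_algebra_add finite_support\<close>)
  show "\<zero>\<^bsub>F\<^esub> \<in> carrier F"
    by (intro free_algebra_carrierI[where A = "{}"]) (simp_all add: free_algebra_zero)
  show "\<exists>g\<in>carrier F. g \<oplus>\<^bsub>F\<^esub> f = \<zero>\<^bsub>F\<^esub>" if "f \<in> carrier F" for f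
  proof
    show "(\<lambda>w. \<ominus> f w) \<in> carrier F"
      using that by (rule carrier_mono_support) (use that in auto)
    show "(\<lambda>w. \<ominus> f w) \<oplus>\<^bsub>F\<^esub> f = \<zero>\<^bsub>F\<^esub>"
      using that by (auto simp: fun_eq_iff free_algebra_add free_algebra_zero l_neg)
  qed
qed (simp_all add: fun_eq_iff free_algebra_add free_algebra_zero a_ac)

lemma free_algebra_nonunital_ring: "nonunital_ring F"
proof -
  have "f \<otimes>\<^bsub>F\<^esub> g \<in> carrier F" if fg: "f \<in> carrier F" "g \<in> carrier F" for f g
  proof (rule free_algebra_carrierI)
    show "finite ((\<lambda>(u, v). u @ v) ` ({w. f w \<noteq> \<zero>} \<times> {w. g w \<noteq> \<zero>}))"
      using fg by (simp add: finite_support)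
    fix w assume "(f \<otimes>\<^bsub>F\<^esub> g) w \<noteq> \<zero>"
    then obtain u v where uv: "w = u @ v" "f u \<noteq> \<zero>" "g v \<noteq> \<zero>"
      using fg convolution_support[of f g w] by (auto simp: free_algebra_mult)
    then show "w \<noteq> [] \<and> set w \<subseteq> X"
      using fg supportD by fastforce
    show "w \<in> (\<lambda>(u, v). u @ v) ` ({w. f w \<noteq> \<zero>} \<times> {w. g w \<noteq> \<zero>})"
      using uv by auto
  qed (use fg in \<open>simp add: free_algebra_mult convolution_closed\<close>)
  then show ?thesis
    using free_algebra_abelian_group
    by (intro nonunital_ring.intro nonunital_ring_axioms.intro)
      (simp_all add: fun_eq_iff free_algebra_mult free_algebra_add[abs_def]
        convolution_assoc convolution_add_left convolution_add_right)
qed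

sublocale F: nonunital_ring F
  by (rule free_algebra_nonunital_ring)

lemma free_algebra_minus:
  assumes "f \<in> carrier F"
  shows "(\<ominus>\<^bsub>F\<^esub> f) w = \<ominus> f w"
proof -
  have "(\<ominus>\<^bsub>F\<^esub> f) w \<oplus> f w = \<zero>"
    using F.l_neg[OF assms] by (metis free_algebra_add free_algebra_zero)
  then show ?thesis
    using assms by (intro minus_equality[symmetric]) simp_all
qed

lemma free_algebra_diff:
  assumes "f \<in> carrier F" "g \<in> carrier F"
  shows "(f \<ominus>\<^bsub>F\<^esub> g) w = f w \<ominus> g w"
  using assms by (simp add: a_minus_def free_algebra_add free_algebra_minus)

lemma free_algebra_finsum:
  assumes "f \<in> A \<rightarrow> carrier F"
  shows "finsum F f A w = (\<Oplus>i\<in>A. f i w)"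
  using assms
  by (induction A rule: infinite_finite_induct)
    (auto simp: free_algebra_zero free_algebra_add Pi_iff)

lemma monomial_closed:
  assumes "c \<in> carrier R" "u \<noteq> []" "set u \<subseteq> X"
  shows "monomial c u \<in> carrier F"
  by (rule free_algebra_carrierI[where A = "{u}"]) (use assms in \<open>auto simp: monomial_def split: if_splits\<close>)

lemma monomial_mult:
  assumes "c \<in> carrier R" "d \<in> carrier R"
  shows "monomial c u \<otimes>\<^bsub>F\<^esub> monomial d v = monomial (c \<otimes> d) (u @ v)"
  using assms by (simp add: free_algebra_mult convolution_monomial)

text \<open>
  Every element is the sum of its monomials, so additive properties need only be checked on these.
\<close>

lemma in_additive_subgroup_if_monomials:
  assumes "additive_subgroup H F" "p \<in> carrier F"
    and monomials: "\<And>w. p w \<noteq> \<zero> \<Longrightarrow> monomial (p w) w \<in> H"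
  shows "p \<in> H"
proof -
  let ?W = "{w. p w \<noteq> \<zero>}"
  have "p = (\<Oplus>\<^bsub>F\<^esub>w\<in>?W. monomial (p w) w)"
  proof
    fix u
    have "(\<lambda>w. monomial (p w) w) \<in> ?W \<rightarrow> carrier F"
      using assms(2) by (auto intro!: monomial_closed dest: supportD)
    then have "(\<Oplus>\<^bsub>F\<^esub>w\<in>?W. monomial (p w) w) u = (\<Oplus>w\<in>?W. if u = w then p w else \<zero>)"
      by (simp add: free_algebra_finsum monomial_def)
    also have "\<dots> = p u"
    proof (cases "p u = \<zero>")
      case True
      then show ?thesis by (intro trans[OF add.finprod_one_eqI]) auto
    next
      case False
      then show ?thesis
        using assms(2) by (intro finsum_singleton) (auto simp: finite_support)
    qed
    finally show "p u = (\<Oplus>\<^bsub>F\<^esub>w\<in>?W. monomial (p w) w) u" by simp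
  qed
  moreover have "(\<Oplus>\<^bsub>F\<^esub>w\<in>?W. monomial (p w) w) \<in> H"
    using assms(1) by (rule F.finsum_in_additive_subgroup) (use monomials in auto)
  ultimately show ?thesis by simp
qed

lemma scale_closed:
  assumes "c \<in> carrier R" "p \<in> carrier F"
  shows "(\<lambda>w. c \<otimes> p w) \<in> carrier F" "(\<lambda>w. p w \<otimes> c) \<in> carrier F"
  using assms by (auto intro: carrier_mono_support)

lemma algebra_ideal_carrier: "algebra_ideal R X (carrier F)"
  unfolding algebra_ideal_def
  by (auto simp: scale_closed F.mult_closed intro: F.additive_subgroup_criterion)

lemma generated_ideal_superset: "P \<subseteq> generated_ideal R X P"
  by (auto simp: generated_ideal_def)

lemma generated_ideal_minimal: "\<lbrakk>algebra_ideal R X I; P \<subseteq> I\<rbrakk> \<Longrightarrow> generated_ideal R X P \<subseteq> I"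
  by (auto simp: generated_ideal_def)

lemma generated_ideal_algebra_ideal:
  assumes "P \<subseteq> carrier F"
  shows "algebra_ideal R X (generated_ideal R X P)"
proof -
  let ?\<I> = "{I. algebra_ideal R X I \<and> P \<subseteq> I}"
  have "carrier F \<in> ?\<I>"
    using assms algebra_ideal_carrier by simp
  then have "subgroup (\<Inter>?\<I>) (add_monoid F)"
    by (intro F.add.subgroups_Inter)
      (auto simp: algebra_ideal_def additive_subgroup_def)
  then show ?thesis
    unfolding generated_ideal_def algebra_ideal_def additive_subgroup_def
    by blast
qed

lemma algebra_ideal_imp_nonunital_ideal:
  assumes "algebra_ideal R X I"
  shows "nonunital_ideal I F"
proof -
  interpret I: additive_subgroup I F
    using assms by (simp add: algebra_ideal_def)
  show ?thesis
    by unfold_locales (use assms in \<open>auto simp: algebra_ideal_def\<close>)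
qed

end


section \<open>Homogeneous relations present graded rings\<close>

locale graded_free_algebra = free_nonunital_algebra R X
  for R (structure) and X :: "'x set" +
  fixes deg :: "'x list \<Rightarrow> int"
  assumes deg_append: "deg (u @ v) = deg u + deg v"
begin

definition homogeneous :: "int \<Rightarrow> ('x list \<Rightarrow> 'a) set" where
  "homogeneous n = {p \<in> carrier F. \<forall>w. p w \<noteq> \<zero> \<longrightarrow> deg w = n}"

definition part :: "int \<Rightarrow> ('x list \<Rightarrow> 'a) \<Rightarrow> 'x list \<Rightarrow> 'a" where
  "part n p = (\<lambda>w. if deg w = n then p w else \<zero>)"

lemma homogeneous_carrier: "p \<in> homogeneous n \<Longrightarrow> p \<in> carrier F"
  by (simp add: homogeneous_def)

lemma homogeneousD: "\<lbrakk>p \<in> homogeneous n; deg w \<noteq> n\<rbrakk> \<Longrightarrow> p w = \<zero>"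
  by (auto simp: homogeneous_def)

lemma homogeneousI:
  assumes "p \<in> carrier F" "\<And>w. deg w \<noteq> n \<Longrightarrow> p w = \<zero>"
  shows "p \<in> homogeneous n"
  using assms by (auto simp: homogeneous_def)

lemma part_closed [simp]: "p \<in> carrier F \<Longrightarrow> part n p \<in> carrier F"
  by (rule carrier_mono_support[of p]) (auto simp: part_def split: if_splits)

lemma part_homogeneous: "p \<in> carrier F \<Longrightarrow> part n p \<in> homogeneous n"
  by (rule homogeneousI, erule part_closed) (simp add: part_def)

lemma part_of_homogeneous: "p \<in> homogeneous m \<Longrightarrow> part n p = (if n = m then p else \<zero>\<^bsub>F\<^esub>)"
  by (auto simp: part_def fun_eq_iff free_algebra_zero homogeneousD)

lemma homogeneous_additive_subgroup: "additive_subgroup (homogeneous n) F"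
  by (rule F.additive_subgroup_criterion)
    (auto intro!: homogeneousI simp: homogeneous_carrier free_algebra_zero free_algebra_add
      free_algebra_minus homogeneousD)

lemma homogeneous_diff:
  assumes "p \<in> homogeneous n" "q \<in> homogeneous n"
  shows "p \<ominus>\<^bsub>F\<^esub> q \<in> homogeneous n"
proof -
  interpret H: additive_subgroup "homogeneous n" F
    by (rule homogeneous_additive_subgroup)
  show ?thesis
    using assms by (simp add: a_minus_def)
qed

lemma monomial_homogeneous:
  "\<lbrakk>c \<in> carrier R; u \<noteq> []; set u \<subseteq> X\<rbrakk> \<Longrightarrow> monomial c u \<in> homogeneous (deg u)"
  by (intro homogeneousI monomial_closed) (auto simp: monomial_def)

lemma homogeneous_mult:
  assumes p: "p \<in> homogeneous m" and q: "q \<in> homogeneous n"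
  shows "p \<otimes>\<^bsub>F\<^esub> q \<in> homogeneous (m + n)"
proof (rule homogeneousI)
  show "p \<otimes>\<^bsub>F\<^esub> q \<in> carrier F"
    using p q by (simp add: homogeneous_carrier F.mult_closed)
  fix w assume w: "deg w \<noteq> m + n"
  show "(p \<otimes>\<^bsub>F\<^esub> q) w = \<zero>"
  proof (rule ccontr)
    assume "(p \<otimes>\<^bsub>F\<^esub> q) w \<noteq> \<zero>"
    then obtain u v where "w = u @ v" "p u \<noteq> \<zero>" "q v \<noteq> \<zero>"
      using convolution_support[of p q w] p q homogeneous_carrier
      by (metis coefficient_closed free_algebra_mult)
    then show False
      using w p q homogeneousD deg_append by metis
  qed
qed

lemma part_add:
  assumes "p \<in> carrier F" "q \<in> carrier F"
  shows "part n (p \<oplus>\<^bsub>F\<^esub> q) = part n p \<oplus>\<^bsub>F\<^esub> part n q"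
  by (auto simp: part_def free_algebra_add fun_eq_iff)

lemma part_minus:
  assumes "p \<in> carrier F"
  shows "part n (\<ominus>\<^bsub>F\<^esub> p) = \<ominus>\<^bsub>F\<^esub> part n p"
  using assms by (subst fun_eq_iff) (simp add: free_algebra_minus, simp add: part_def free_algebra_minus)

text \<open>
  In the convolution of \<open>p\<close> with a homogeneous \<open>q\<close> of degree \<open>m\<close>, a splitting of a word of degree
  \<open>n\<close> contributes only if the factor given to \<open>p\<close> has degree \<open>n - m\<close>.
\<close>

lemma part_mult_homogeneous:
  assumes "p \<in> carrier F" "q \<in> homogeneous m"
  shows "part n (p \<otimes>\<^bsub>F\<^esub> q) = part (n - m) p \<otimes>\<^bsub>F\<^esub> q"
    and "part n (q \<otimes>\<^bsub>F\<^esub> p) = q \<otimes>\<^bsub>F\<^esub> part (n - m) p"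
proof -
  have q: "q \<in> carrier F"
    using assms(2) by (rule homogeneous_carrier)
  have deg_split: "deg w = deg (take i w) + deg (drop i w)" for w i
    using deg_append[of "take i w" "drop i w"] by simp
  have "(if deg w = n then p (take i w) \<otimes> q (drop i w) else \<zero>) = part (n - m) p (take i w) \<otimes> q (drop i w)"
    for i w
    using assms q deg_split[of w i] homogeneousD[OF assms(2), of "drop i w"]
    by (cases "deg (drop i w) = m") (auto simp: part_def)
  moreover have "part n (p \<otimes>\<^bsub>F\<^esub> q) w =
      (\<Oplus>i\<in>{..length w}. if deg w = n then p (take i w) \<otimes> q (drop i w) else \<zero>)" for w
    by (simp add: part_def free_algebra_mult convolution_def)
  ultimately show "part n (p \<otimes>\<^bsub>F\<^esub> q) = part (n - m) p \<otimes>\<^bsub>F\<^esub> q"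
    by (simp add: fun_eq_iff free_algebra_mult convolution_def)
  have "(if deg w = n then q (take i w) \<otimes> p (drop i w) else \<zero>) = q (take i w) \<otimes> part (n - m) p (drop i w)"
    for i w
    using assms q deg_split[of w i] homogeneousD[OF assms(2), of "take i w"]
    by (cases "deg (take i w) = m") (auto simp: part_def)
  moreover have "part n (q \<otimes>\<^bsub>F\<^esub> p) w =
      (\<Oplus>i\<in>{..length w}. if deg w = n then q (take i w) \<otimes> p (drop i w) else \<zero>)" for w
    by (simp add: part_def free_algebra_mult convolution_def)
  ultimately show "part n (q \<otimes>\<^bsub>F\<^esub> p) = q \<otimes>\<^bsub>F\<^esub> part (n - m) p"
    by (simp add: fun_eq_iff free_algebra_mult convolution_def)
qed

lemma sum_of_parts:
  assumes p: "p \<in> carrier F" and N: "finite N" "\<And>w. p w \<noteq> \<zero> \<Longrightarrow> deg w \<in> N"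
  shows "(\<Oplus>\<^bsub>F\<^esub>n\<in>N. part n p) = p"
proof
  fix w
  have "(\<Oplus>\<^bsub>F\<^esub>n\<in>N. part n p) w = (\<Oplus>n\<in>N. if deg w = n then p w else \<zero>)"
    using p by (subst free_algebra_finsum, simp) (simp add: part_def)
  also have "\<dots> = p w"
  proof (cases "deg w \<in> N")
    case True
    then show ?thesis
      using p N(1) finsum_singleton[of "deg w" N "\<lambda>_. p w"] by simp
  next
    case False
    then have "p w = \<zero>"
      using N(2) by blast
    then show ?thesis
      by (simp add: add.finprod_one_eqI)
  qed
  finally show "(\<Oplus>\<^bsub>F\<^esub>n\<in>N. part n p) w = p w" .
qed

lemma part_of_sum:
  assumes N: "finite N" and p: "\<And>n. n \<in> N \<Longrightarrow> p n \<in> homogeneous n"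
  shows "part m (\<Oplus>\<^bsub>F\<^esub>n\<in>N. p n) = (if m \<in> N then p m else \<zero>\<^bsub>F\<^esub>)"
  using assms
proof (induction N rule: finite_induct)
  case empty
  then show ?case
    by (simp add: part_def free_algebra_zero fun_eq_iff)
next
  case (insert n N)
  then have "p \<in> N \<rightarrow> carrier F" "p n \<in> carrier F"
    by (auto intro: homogeneous_carrier)
  moreover have "part m (p n) = (if m = n then p n else \<zero>\<^bsub>F\<^esub>)"
    using insert.prems by (intro part_of_homogeneous) simp
  ultimately show ?case
    using insert homogeneous_carrier[OF insert.prems] by (auto simp: part_add)
qed

end

locale homogeneous_presentation = graded_free_algebra R X deg
  for R (structure) and X :: "'x set" and deg +
  fixes P :: "('x list \<Rightarrow> 'a) set"
  assumes relations_homogeneous: "p \<in> P \<Longrightarrow> \<exists>n. p \<in> homogeneous n"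
begin

abbreviation "I \<equiv> generated_ideal R X P"

lemma relations_subset: "P \<subseteq> carrier F"
  using relations_homogeneous homogeneous_carrier by blast

sublocale I: nonunital_ideal I F
  by (rule algebra_ideal_imp_nonunital_ideal[OF generated_ideal_algebra_ideal[OF relations_subset]])

sublocale Q: nonunital_ring "F Quot I"
  by (rule I.quotient_nonunital_ring)

text \<open>
  The elements all of whose parts lie in \<open>I\<close> form an ideal \<open>J\<close>; closure under products holds for
  monomial factors by \<open>part_mult_homogeneous\<close> and follows for all factors by additivity. As the
  relations are homogeneous they lie in \<open>J\<close>, so \<open>I \<subseteq> J\<close>.
\<close>

lemma part_in_ideal:
  assumes "p \<in> I"
  shows "part n p \<in> I"
proof -
  define J where "J = {p \<in> carrier F. \<forall>n. part n p \<in> I}"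
  have zero: "part n \<zero>\<^bsub>F\<^esub> = \<zero>\<^bsub>F\<^esub>" for n
    by (simp add: part_def free_algebra_zero fun_eq_iff)
  have J: "additive_subgroup J F"
    by (rule F.additive_subgroup_criterion) (auto simp: J_def zero part_add part_minus)
  interpret J: additive_subgroup J F by (rule J)
  have mult: "q \<otimes>\<^bsub>F\<^esub> p \<in> J \<and> p \<otimes>\<^bsub>F\<^esub> q \<in> J" if p: "p \<in> J" and q: "q \<in> carrier F" for p q
  proof -
    have p': "p \<in> carrier F"
      using p unfolding J_def by blast
    have "q \<in> {q \<in> carrier F. q \<otimes>\<^bsub>F\<^esub> p \<in> J \<and> p \<otimes>\<^bsub>F\<^esub> q \<in> J}"
    proof (rule in_additive_subgroup_if_monomials[OF F.additive_subgroup_criterion q])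
      fix w assume "q w \<noteq> \<zero>"
      then have w: "monomial (q w) w \<in> homogeneous (deg w)"
        using q supportD by (intro monomial_homogeneous) auto
      then have "monomial (q w) w \<in> carrier F"
        by (rule homogeneous_carrier)
      moreover have "part n p \<in> I" for n
        using p unfolding J_def by blast
      ultimately show "monomial (q w) w \<in> {q \<in> carrier F. q \<otimes>\<^bsub>F\<^esub> p \<in> J \<and> p \<otimes>\<^bsub>F\<^esub> q \<in> J}"
        unfolding J_def mem_Collect_eq part_mult_homogeneous(1)[OF p' w] part_mult_homogeneous(2)[OF p' w]
        using p' by (blast intro: F.mult_closed I.mult_ideal_closed I.ideal_mult_closed)
    qed (auto simp: p' F.mult_distr_left F.mult_distr_right F.minus_mult F.mult_minus)
    then show ?thesis by simp
  qed
  have scale: "(\<lambda>w. c \<otimes> p w) \<in> J \<and> (\<lambda>w. p w \<otimes> c) \<in> J" if p: "p \<in> J" and c: "c \<in> carrier R" for p c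
  proof -
    have "part n (\<lambda>w. c \<otimes> p w) = (\<lambda>w. c \<otimes> part n p w)" "part n (\<lambda>w. p w \<otimes> c) = (\<lambda>w. part n p w \<otimes> c)" for n
      using c by (auto simp: part_def)
    moreover have "p \<in> carrier F" "part n p \<in> I" for n
      using p unfolding J_def by blast+
    ultimately show ?thesis
      using c generated_ideal_algebra_ideal[OF relations_subset]
      unfolding J_def mem_Collect_eq algebra_ideal_def by (simp add: scale_closed)
  qed
  have "algebra_ideal R X J"
    using J mult scale by (simp add: algebra_ideal_def)
  moreover have "P \<subseteq> J"
  proof
    fix p assume p: "p \<in> P"
    then obtain m where "p \<in> homogeneous m"
      using relations_homogeneous by blast
    moreover have "p \<in> I"
      using p generated_ideal_superset by blast
    ultimately show "p \<in> J"
      unfolding J_def by (simp add: part_of_homogeneous homogeneous_carrier)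
  qed
  ultimately have "I \<subseteq> J"
    by (rule generated_ideal_minimal)
  with assms show ?thesis
    unfolding J_def by blast
qed

text \<open>
  Existence of a decomposition comes from the parts of a representative. For uniqueness, lift any
  decomposition to homogeneous representatives: their sum differs from the given representative by
  an element of \<open>I\<close>, and the parts of this difference are again in \<open>I\<close>.
\<close>

lemma quotient_graded_ring:
  "graded_ring integer_group (F Quot I) (\<lambda>n. (+>\<^bsub>F\<^esub>) I ` homogeneous n)"
proof (intro graded_ring.intro graded_ring_axioms.intro group_integer_group Q.nonunital_ring_axioms)
  let ?A = "\<lambda>n. (+>\<^bsub>F\<^esub>) I ` homogeneous n" and ?Q = "F Quot I"
  show "additive_subgroup (?A n) ?Q" for n
    by (rule I.coset_image_additive_subgroup[OF homogeneous_additive_subgroup])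
  show "ideal_prod ?Q (?A m) (?A n) \<subseteq> ?A (m \<otimes>\<^bsub>integer_group\<^esub> n)" for m n
  proof
    interpret A: additive_subgroup "?A (m + n)" ?Q
      by (rule I.coset_image_additive_subgroup[OF homogeneous_additive_subgroup])
    fix x assume "x \<in> ideal_prod ?Q (?A m) (?A n)"
    then have "x \<in> ?A (m + n)"
      by induction (auto simp: I.coset_mult homogeneous_carrier homogeneous_mult)
    then show "x \<in> ?A (m \<otimes>\<^bsub>integer_group\<^esub> n)"
      by simp
  qed
  fix x assume "x \<in> carrier ?Q"
  then obtain p where p: "p \<in> carrier F" and x: "x = I +>\<^bsub>F\<^esub> p"
    by (auto simp: I.quotient_carrier)
  let ?supp = "\<lambda>f. {n \<in> carrier integer_group. f n \<noteq> \<zero>\<^bsub>?Q\<^esub>}"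
  let ?parts = "\<lambda>n. I +>\<^bsub>F\<^esub> part n p"
  show "\<exists>!f. f \<in> (\<Pi>\<^sub>E n\<in>carrier integer_group. ?A n) \<and> finite (?supp f) \<and>
      x = (\<Oplus>\<^bsub>?Q\<^esub>n\<in>?supp f. f n)"
  proof (rule ex1I[of _ ?parts], intro conjI)
    show "?parts \<in> (\<Pi>\<^sub>E n\<in>carrier integer_group. ?A n)"
      using p by (auto simp: part_homogeneous)
    let ?N = "deg ` {w. p w \<noteq> \<zero>}"
    have N: "finite ?N"
      using p by (simp add: finite_support)
    have supp: "?supp ?parts \<subseteq> ?N"
    proof
      fix n assume n: "n \<in> ?supp ?parts"
      show "n \<in> ?N"
      proof (rule ccontr)
        assume "n \<notin> ?N"
        then have "part n p = \<zero>\<^bsub>F\<^esub>"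
          by (auto simp: part_def free_algebra_zero fun_eq_iff)
        with n show False
          by (simp add: I.quotient_zero I.coset_eq_zero_iff)
      qed
    qed
    then show "finite (?supp ?parts)"
      using N by (rule finite_subset)
    have "(\<Oplus>\<^bsub>?Q\<^esub>n\<in>?supp ?parts. ?parts n) = (\<Oplus>\<^bsub>?Q\<^esub>n\<in>?N. ?parts n)"
      using p N supp by (intro Q.add.finprod_mono_neutral_cong_left) auto
    also have "\<dots> = x"
      using p N by (simp add: I.coset_finsum sum_of_parts x)
    finally show "x = (\<Oplus>\<^bsub>?Q\<^esub>n\<in>?supp ?parts. ?parts n)" ..
  next
    fix f
    assume f: "f \<in> (\<Pi>\<^sub>E n\<in>carrier integer_group. ?A n) \<and> finite (?supp f) \<and>
      x = (\<Oplus>\<^bsub>?Q\<^esub>n\<in>?supp f. f n)"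
    then have "\<forall>n. \<exists>q. q \<in> homogeneous n \<and> f n = I +>\<^bsub>F\<^esub> q"
      by (auto simp: PiE_iff)
    then obtain q where q: "q n \<in> homogeneous n" "f n = I +>\<^bsub>F\<^esub> q n" for n
      by metis
    let ?q = "\<Oplus>\<^bsub>F\<^esub>n\<in>?supp f. q n"
    have q': "?q \<in> carrier F"
      using homogeneous_carrier[OF q(1)] by (intro F.finsum_closed) simp
    have "x = I +>\<^bsub>F\<^esub> ?q"
      using f by (simp add: q(2) I.coset_finsum homogeneous_carrier[OF q(1)])
    then have diff: "p \<ominus>\<^bsub>F\<^esub> ?q \<in> I"
      using p q' by (simp add: x I.coset_eq_iff)
    show "f = ?parts"
    proof
      fix n
      have "part n p \<ominus>\<^bsub>F\<^esub> part n ?q \<in> I"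
        using part_in_ideal[OF diff, of n] p q' by (simp add: a_minus_def part_add part_minus)
      then have "?parts n = I +>\<^bsub>F\<^esub> part n ?q"
        using p q' by (simp add: I.coset_eq_iff)
      also have "\<dots> = f n"
      proof -
        have "part n ?q = (if n \<in> ?supp f then q n else \<zero>\<^bsub>F\<^esub>)"
          using f q(1) by (intro part_of_sum) simp_all
        then show ?thesis
          by (simp add: q(2) I.quotient_zero I.a_rcos_const)
      qed
      finally show "f n = ?parts n" ..
    qed
  qed
qed

end


section \<open>Walks in a finite digraph\<close>

context fin_digraph
begin

lemma walk_suffix:
  assumes "awalk u p v" "k \<le> length p"
  shows "\<exists>w q. awalk w q v \<and> length q = k"
proof -
  have "awalk u (take (length p - k) p @ drop (length p - k) p) v"
    using assms(1) by simp
  then have "awalk (awlast u (take (length p - k) p)) (drop (length p - k) p) v"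
    using awalk_append_iff by blast
  with assms(2) show ?thesis
    by (intro exI[of _ "awlast u (take (length p - k) p)"] exI[of _ "drop (length p - k) p"]) simp
qed

text \<open>
  The sets \<open>V k\<close> of end vertices of walks of length \<open>k\<close> decrease, since suffixes of walks are walks.
  Choosing \<open>N\<close> with \<open>V N\<close> of least cardinality gives \<open>V k = V N\<close> for all \<open>k \<ge> N\<close>.
\<close>

lemma long_walk_imp_all_lengths:
  obtains N where "\<And>u p v k. \<lbrakk>awalk u p v; N \<le> length p\<rbrakk> \<Longrightarrow> \<exists>w q. awalk w q v \<and> length q = k"
proof -
  define V where "V k = {v. \<exists>u p. awalk u p v \<and> length p = k}" for k
  have fin: "finite (V k)" for k
    by (rule finite_subset[of _ "verts G"]) (auto simp: V_def awalk_last_in_verts)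
  have antimono: "V k \<subseteq> V l" if "l \<le> k" for k l
    using that walk_suffix by (auto simp: V_def)
  obtain N where N: "card (V N) \<le> card (V k)" for k
    using ex_has_least_nat[of "\<lambda>_. True" 0 "\<lambda>k. card (V k)"] by auto
  have V: "V N \<subseteq> V k" for k
  proof (cases "k \<le> N")
    case False
    then have "V k = V N"
      by (intro card_subset_eq fin antimono antisym N card_mono) simp_all
    then show ?thesis by simp
  qed (rule antimono)
  show thesis
  proof (rule that)
    fix u p v k assume "awalk u p v" "N \<le> length p"
    then have "v \<in> V N"
      using walk_suffix by (auto simp: V_def)
    with V[of k] have "v \<in> V k" ..
    then show "\<exists>w q. awalk w q v \<and> length q = k"
      by (simp add: V_def)
  qed
qed

text \<open>
  The walks \<open>p\<close> that occur in a product \<open>p q\<^sup>*\<close> of degree \<open>n\<close>. The start vertex is recorded, because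
  the empty list of edges does not determine it.
\<close>

definition leading_walks :: "int \<Rightarrow> ('a \<times> 'b list) set" where
  "leading_walks n = {(u, p). \<exists>v w q. awalk u p v \<and> awalk w q v \<and> int (length p) - int (length q) = n}"

definition minimal_walks :: "int \<Rightarrow> ('a \<times> 'b list) set" where
  "minimal_walks n = {(u, p) \<in> leading_walks n. \<forall>k<length p. (u, take k p) \<notin> leading_walks n}"

lemma minimal_walks_subset: "minimal_walks n \<subseteq> leading_walks n"
  by (auto simp: minimal_walks_def)

text \<open>
  A walk of length \<open>M = max N n\<close>, with \<open>N\<close> from \<open>long_walk_imp_all_lengths\<close>, is leading: its end vertex also
  ends a walk of length \<open>M - n\<close>. So a minimal walk cannot have a proper prefix of length \<open>M\<close>.
\<close>

lemma finite_minimal_walks: "finite (minimal_walks n)"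
proof -
  obtain N where N: "\<And>u p v k. \<lbrakk>awalk u p v; N \<le> length p\<rbrakk> \<Longrightarrow> \<exists>w q. awalk w q v \<and> length q = k"
    using long_walk_imp_all_lengths by blast
  define M where "M = max N (nat n)"
  have "length p \<le> M" if min: "(u, p) \<in> minimal_walks n" for u p
  proof (rule ccontr)
    assume "\<not> length p \<le> M"
    then have len: "M < length p" "length (take M p) = M"
      by simp_all
    from min obtain v where "awalk u (take M p @ drop M p) v"
      by (auto simp: minimal_walks_def leading_walks_def)
    then have walk: "awalk u (take M p) (awlast u (take M p))"
      using awalk_append_iff by blast
    have M: "N \<le> M" "nat n \<le> M"
      by (simp_all add: M_def)
    obtain w q where "awalk w q (awlast u (take M p))" "length q = nat (int M - n)"
      using N[OF walk] M(1) unfolding len(2) by blast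
    moreover from this M(2) have "int (length (take M p)) - int (length q) = n"
      unfolding len(2) by simp
    ultimately have "(u, take M p) \<in> leading_walks n"
      unfolding leading_walks_def using walk by blast
    with min len(1) show False
      by (auto simp: minimal_walks_def)
  qed
  moreover have "u \<in> verts G" "set p \<subseteq> arcs G" if "(u, p) \<in> minimal_walks n" for u p
    using that by (auto simp: minimal_walks_def leading_walks_def)
  ultimately have "minimal_walks n \<subseteq> verts G \<times> {p. set p \<subseteq> arcs G \<and> length p \<le> M}"
    by (intro subrelI) simp
  then show ?thesis
    by (rule finite_subset) (intro finite_cartesian_product finite_lists_length_le finite_verts finite_arcs)
qed

text \<open>
  The shortest leading prefix \<open>p0\<close> of \<open>p\<close> is minimal. A minimal walk comparable to \<open>p\<close> is comparable
  to \<open>p0\<close>, and two comparable minimal walks coincide.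
\<close>

lemma minimal_walk_prefix:
  assumes "(u, p) \<in> leading_walks n"
  obtains p0 p' where "(u, p0) \<in> minimal_walks n" "p = p0 @ p'"
    "\<And>p1. \<lbrakk>(u, p1) \<in> minimal_walks n; p1 \<noteq> p0\<rbrakk> \<Longrightarrow> p1 \<parallel> p"
proof -
  define k where "k = (LEAST k. (u, take k p) \<in> leading_walks n)"
  have k: "(u, take k p) \<in> leading_walks n"
    unfolding k_def by (rule LeastI[of _ "length p"]) (use assms in simp)
  have least: "k \<le> l" if "(u, take l p) \<in> leading_walks n" for l
    unfolding k_def using that by (rule Least_le)
  have k_le: "k \<le> length p"
    using least[of "length p"] assms by simp
  show thesis
  proof (rule that)
    show "(u, take k p) \<in> minimal_walks n"
      using k k_le least[THEN leD] by (auto simp: minimal_walks_def min_absorb1)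
    show "p = take k p @ drop k p" by simp
    fix p1 assume p1: "(u, p1) \<in> minimal_walks n" "p1 \<noteq> take k p"
    show "p1 \<parallel> p"
    proof
      show "\<not> prefix p1 p"
      proof
        assume "prefix p1 p"
        then have *: "p1 = take (length p1) p"
          by (auto elim: prefixE)
        then have "k \<le> length p1"
          using least[of "length p1"] p1 minimal_walks_subset by auto
        moreover have "\<not> k < length p1"
        proof
          assume "k < length p1"
          moreover from this have "take k p1 = take k p"
            by (subst *) (simp add: min_def)
          ultimately show False
            using p1 k by (auto simp: minimal_walks_def)
        qed
        ultimately show False
          using p1(2) * by (metis le_neq_implies_less)
      qed
      show "\<not> prefix p p1"
      proof
        assume "prefix p p1"
        then obtain r where r: "p1 = p @ r" by (auto elim: prefixE)
        then have "take k p1 = take k p"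
          using k_le by simp
        moreover have "k < length p1"
          using r k_le p1(2) by (cases "k = length p1") auto
        ultimately show False
          using p1 k by (auto simp: minimal_walks_def)
      qed
    qed
  qed
qed

end


section \<open>Leavitt path algebras are graded\<close>

locale leavitt = ring R + fin_digraph E
  for R (structure) and E :: "('v, 'e) pre_digraph"
begin

sublocale graded_free_algebra R "generators E" word_degree
  by unfold_locales (simp add: word_degree_def)

lemma word_homogeneous:
  assumes "u \<noteq> []" "set u \<subseteq> generators E" "word_degree u = n"
  shows "word R u \<in> homogeneous n"
  using assms monomial_homogeneous[of \<one> u] by (simp add: word_eq_monomial)

lemma zero_homogeneous: "\<zero>\<^bsub>F\<^esub> \<in> homogeneous n"
  using homogeneous_additive_subgroup by (rule additive_subgroup.zero_closed)

sublocale homogeneous_presentation R "generators E" word_degree "leavitt_relations R E"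
proof unfold_locales
  have arc_gens: "Vertex (tail E f) \<in> generators E" "Vertex (head E f) \<in> generators E"
    "Edge f \<in> generators E" "Ghost f \<in> generators E" if "f \<in> arcs E" for f
    using that by (auto simp: generators_def)
  have vert_gens: "Vertex v \<in> generators E" if "v \<in> verts E" for v
    using that by (simp add: generators_def)
  have diff: "\<exists>n. a \<ominus>\<^bsub>F\<^esub> b \<in> homogeneous n" if "a \<in> homogeneous n" "b \<in> homogeneous n" for a b n
    using homogeneous_diff[OF that] by blast
  have word: "word R u \<in> homogeneous n"
    if "word_degree u = n" "u \<noteq> []" "set u \<subseteq> generators E" for u n
    using that word_homogeneous by blast
  fix p assume "p \<in> leavitt_relations R E"
  then show "\<exists>n. p \<in> homogeneous n"
  proof cases
    case (vertex_vertex u v)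
    then show ?thesis
      unfolding vertex_vertex(1)
      by (intro diff[of _ 0]) (auto intro!: word zero_homogeneous simp: word_degree_def vert_gens)
  next
    case (source_edge f)
    then show ?thesis
      unfolding source_edge(1)
      by (intro diff[of _ 1] word) (auto simp: word_degree_def arc_gens)
  next
    case (edge_range f)
    then show ?thesis
      unfolding edge_range(1)
      by (intro diff[of _ 1] word) (auto simp: word_degree_def arc_gens)
  next
    case (range_ghost f)
    then show ?thesis
      unfolding range_ghost(1)
      by (intro diff[of _ "-1"] word) (auto simp: word_degree_def arc_gens)
  next
    case (ghost_source f)
    then show ?thesis
      unfolding ghost_source(1)
      by (intro diff[of _ "-1"] word) (auto simp: word_degree_def arc_gens)
  next
    case (ghost_edge f f')
    then show ?thesis
      unfolding ghost_edge(1)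
      by (intro diff[of _ 0]) (auto intro!: word zero_homogeneous simp: word_degree_def arc_gens)
  next
    case (edge_ghost_sum v)
    have "(\<Oplus>\<^bsub>F\<^esub>f\<in>out_arcs E v. word R [Edge f, Ghost f]) \<in> homogeneous 0"
      by (intro F.finsum_in_additive_subgroup homogeneous_additive_subgroup Pi_I word)
        (auto simp: word_degree_def arc_gens)
    then show ?thesis
      unfolding edge_ghost_sum(1)
      by (intro diff[of _ 0] word) (auto simp: word_degree_def vert_gens edge_ghost_sum)
  qed
qed

abbreviation "Q \<equiv> F Quot I"

lemma leavitt_path_algebra_eq: "leavitt_path_algebra R E = Q"
  by (simp add: leavitt_path_algebra_def leavitt_ideal_def)

lemma leavitt_component_eq: "leavitt_component R E n = (+>\<^bsub>F\<^esub>) I ` homogeneous n"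
  by (simp add: leavitt_component_def leavitt_ideal_def homogeneous_def)

sublocale L: graded_ring integer_group Q "leavitt_component R E"
  using quotient_graded_ring by (simp add: leavitt_component_eq[abs_def])


section \<open>Calculating with classes of words\<close>

abbreviation gens :: "('v, 'e) generator list \<Rightarrow> bool" where
  "gens w \<equiv> set w \<subseteq> generators E"

definition mono_class :: "'a \<Rightarrow> ('v, 'e) generator list \<Rightarrow> (('v, 'e) generator list \<Rightarrow> 'a) set" where
  "mono_class c w = I +>\<^bsub>F\<^esub> monomial c w"

lemma mono_class_closed [simp]:
  "\<lbrakk>c \<in> carrier R; w \<noteq> []; gens w\<rbrakk> \<Longrightarrow> mono_class c w \<in> carrier Q"
  by (simp add: mono_class_def monomial_closed)

lemma mono_class_mult:
  assumes "c \<in> carrier R" "d \<in> carrier R" "u \<noteq> []" "gens u" "w \<noteq> []" "gens w"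
  shows "mono_class c u \<otimes>\<^bsub>Q\<^esub> mono_class d w = mono_class (c \<otimes> d) (u @ w)"
  using assms by (simp add: mono_class_def I.coset_mult monomial_closed monomial_mult)

lemma mono_class_component:
  assumes "c \<in> carrier R" "w \<noteq> []" "gens w" "word_degree w = n"
  shows "mono_class c w \<in> leavitt_component R E n"
  using assms monomial_homogeneous[of c w] by (auto simp: leavitt_component_eq mono_class_def)

text \<open>
  The generating relations have coefficients \<open>1\<close>. They hold for multiples with an arbitrary
  coefficient as well, since the ideal is closed under scaling; this takes the place of the
  factorisation \<open>c u = (c 1) u\<close>, which would need a unit.
\<close>

lemma mono_class_eq_if_relation:
  assumes c: "c \<in> carrier R" and u: "u \<noteq> []" "gens u" and w: "w \<noteq> []" "gens w"
    and rel: "word R u \<ominus>\<^bsub>F\<^esub> word R w \<in> leavitt_relations R E"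
  shows "mono_class c u = mono_class c w"
proof -
  have "word R u \<ominus>\<^bsub>F\<^esub> word R w \<in> I"
    using rel generated_ideal_superset by blast
  then have "(\<lambda>x. c \<otimes> (word R u \<ominus>\<^bsub>F\<^esub> word R w) x) \<in> I"
    using c generated_ideal_algebra_ideal[OF relations_subset] unfolding algebra_ideal_def by blast
  also have "(\<lambda>x. c \<otimes> (word R u \<ominus>\<^bsub>F\<^esub> word R w) x) = monomial c u \<ominus>\<^bsub>F\<^esub> monomial c w"
    using c u w monomial_closed
    by (auto simp: fun_eq_iff word_eq_monomial free_algebra_diff)
      (simp_all add: monomial_def a_minus_def r_minus r_neg)
  finally show ?thesis
    using c u w by (simp add: mono_class_def I.coset_eq_iff monomial_closed)
qed

lemma mono_class_zero_if_relation:
  assumes c: "c \<in> carrier R" and u: "u \<noteq> []" "gens u"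
    and rel: "word R u \<ominus>\<^bsub>F\<^esub> \<zero>\<^bsub>F\<^esub> \<in> leavitt_relations R E"
  shows "mono_class c u = \<zero>\<^bsub>Q\<^esub>"
proof -
  have "word R u \<ominus>\<^bsub>F\<^esub> \<zero>\<^bsub>F\<^esub> \<in> I"
    using rel generated_ideal_superset by blast
  then have "(\<lambda>x. c \<otimes> (word R u \<ominus>\<^bsub>F\<^esub> \<zero>\<^bsub>F\<^esub>) x) \<in> I"
    using c generated_ideal_algebra_ideal[OF relations_subset] unfolding algebra_ideal_def by blast
  also have "(\<lambda>x. c \<otimes> (word R u \<ominus>\<^bsub>F\<^esub> \<zero>\<^bsub>F\<^esub>) x) = monomial c u"
    using c u monomial_closed
    by (auto simp: fun_eq_iff word_eq_monomial free_algebra_diff free_algebra_zero)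
      (simp_all add: monomial_def a_minus_def)
  finally show ?thesis
    using c u by (simp add: mono_class_def I.quotient_zero I.coset_eq_zero_iff monomial_closed)
qed

lemma vertex_gens [simp]: "v \<in> verts E \<Longrightarrow> Vertex v \<in> generators E"
  and edge_gens [simp]: "e \<in> arcs E \<Longrightarrow> Edge e \<in> generators E"
  and ghost_gens [simp]: "e \<in> arcs E \<Longrightarrow> Ghost e \<in> generators E"
  by (simp_all add: generators_def)

lemma mono_class_relations:
  assumes "c \<in> carrier R"
  shows vertex_vertex_class: "\<lbrakk>u \<in> verts E; v \<in> verts E\<rbrakk> \<Longrightarrow>
      mono_class c [Vertex u, Vertex v] = (if u = v then mono_class c [Vertex v] else \<zero>\<^bsub>Q\<^esub>)"
    and source_edge_class: "e \<in> arcs E \<Longrightarrow>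
      mono_class c [Vertex (tail E e), Edge e] = mono_class c [Edge e]"
    and edge_range_class: "e \<in> arcs E \<Longrightarrow>
      mono_class c [Edge e, Vertex (head E e)] = mono_class c [Edge e]"
    and range_ghost_class: "e \<in> arcs E \<Longrightarrow>
      mono_class c [Vertex (head E e), Ghost e] = mono_class c [Ghost e]"
    and ghost_source_class: "e \<in> arcs E \<Longrightarrow>
      mono_class c [Ghost e, Vertex (tail E e)] = mono_class c [Ghost e]"
    and ghost_edge_class: "\<lbrakk>e \<in> arcs E; f \<in> arcs E\<rbrakk> \<Longrightarrow>
      mono_class c [Ghost e, Edge f] = (if e = f then mono_class c [Vertex (head E e)] else \<zero>\<^bsub>Q\<^esub>)"
proof -
  show "mono_class c [Vertex u, Vertex v] = (if u = v then mono_class c [Vertex v] else \<zero>\<^bsub>Q\<^esub>)"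
    if "u \<in> verts E" "v \<in> verts E"
    using leavitt_relations.vertex_vertex[OF that, of R] that assms
    by (cases "u = v") (simp_all add: mono_class_eq_if_relation mono_class_zero_if_relation)
  show "mono_class c [Ghost e, Edge f] = (if e = f then mono_class c [Vertex (head E e)] else \<zero>\<^bsub>Q\<^esub>)"
    if "e \<in> arcs E" "f \<in> arcs E"
    using leavitt_relations.ghost_edge[OF that, of R] that assms
    by (cases "e = f") (simp_all add: mono_class_eq_if_relation mono_class_zero_if_relation)
qed (rule mono_class_eq_if_relation; simp add: assms leavitt_relations.intros)+


section \<open>Generators as operators\<close>

abbreviation gen :: "('v, 'e) generator \<Rightarrow> (('v, 'e) generator list \<Rightarrow> 'a) set" where
  "gen g \<equiv> mono_class \<one> [g]"

lemma gen_mult_assoc: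
  assumes "g \<in> generators E" "h \<in> generators E" "m \<in> carrier Q"
  shows "gen g \<otimes>\<^bsub>Q\<^esub> (gen h \<otimes>\<^bsub>Q\<^esub> m) = mono_class \<one> [g, h] \<otimes>\<^bsub>Q\<^esub> m"
  using assms by (simp add: Q.mult_assoc[symmetric] mono_class_mult)

text \<open>
  A word acts by left multiplication with its letters, so the empty word acts as the identity although
  it does not represent an element of the algebra. This spares case distinctions for empty walks.
\<close>

definition act :: "('v, 'e) generator list \<Rightarrow> (('v, 'e) generator list \<Rightarrow> 'a) set \<Rightarrow>
    (('v, 'e) generator list \<Rightarrow> 'a) set" where
  "act w m = foldr (\<lambda>g x. gen g \<otimes>\<^bsub>Q\<^esub> x) w m"

lemma act_simps [simp]:
  "act [] m = m" "act (g # w) m = gen g \<otimes>\<^bsub>Q\<^esub> act w m" "act (u @ w) m = act u (act w m)"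
  by (simp_all add: act_def)

lemma act_closed [simp]: "\<lbrakk>gens w; m \<in> carrier Q\<rbrakk> \<Longrightarrow> act w m \<in> carrier Q"
  by (induction w) (simp_all add: Q.mult_closed)

lemma act_zero: "gens w \<Longrightarrow> act w \<zero>\<^bsub>Q\<^esub> = \<zero>\<^bsub>Q\<^esub>"
  by (induction w) simp_all

lemma act_mult:
  "\<lbrakk>gens w; m \<in> carrier Q; n \<in> carrier Q\<rbrakk> \<Longrightarrow> act w m \<otimes>\<^bsub>Q\<^esub> n = act w (m \<otimes>\<^bsub>Q\<^esub> n)"
  by (induction w) (simp_all add: Q.mult_assoc)

lemma act_mono_class:
  "\<lbrakk>gens w; c \<in> carrier R; u \<noteq> []; gens u\<rbrakk> \<Longrightarrow> act w (mono_class c u) = mono_class c (w @ u)"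
  by (induction w) (simp_all add: mono_class_mult)

text \<open>
  The right ideal generated by a vertex; on it that vertex is a left unit and all others act as zero.
\<close>

definition corner :: "'v \<Rightarrow> (('v, 'e) generator list \<Rightarrow> 'a) set set" where
  "corner v = {m \<in> carrier Q. gen (Vertex v) \<otimes>\<^bsub>Q\<^esub> m = m}"

lemma corner_carrier: "m \<in> corner v \<Longrightarrow> m \<in> carrier Q"
  and corner_fixed: "m \<in> corner v \<Longrightarrow> gen (Vertex v) \<otimes>\<^bsub>Q\<^esub> m = m"
  by (simp_all add: corner_def)

lemma vertex_mult_corner:
  assumes "m \<in> corner v" "u \<in> verts E" "v \<in> verts E"
  shows "gen (Vertex u) \<otimes>\<^bsub>Q\<^esub> m = (if u = v then m else \<zero>\<^bsub>Q\<^esub>)"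
proof -
  have "gen (Vertex u) \<otimes>\<^bsub>Q\<^esub> m = mono_class \<one> [Vertex u, Vertex v] \<otimes>\<^bsub>Q\<^esub> m"
    using assms gen_mult_assoc[of "Vertex u" "Vertex v" m] by (simp add: corner_def)
  also have "\<dots> = (if u = v then m else \<zero>\<^bsub>Q\<^esub>)"
    using assms by (simp add: vertex_vertex_class corner_def)
  finally show ?thesis .
qed

lemma edge_mult_corner:
  assumes "m \<in> carrier Q" "e \<in> arcs E"
  shows "gen (Edge e) \<otimes>\<^bsub>Q\<^esub> m \<in> corner (tail E e)"
  using assms gen_mult_assoc[of "Vertex (tail E e)" "Edge e" m]
  by (simp add: corner_def Q.mult_closed source_edge_class)

lemma ghost_mult_corner:
  assumes "m \<in> carrier Q" "e \<in> arcs E"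
  shows "gen (Ghost e) \<otimes>\<^bsub>Q\<^esub> m \<in> corner (head E e)"
  using assms gen_mult_assoc[of "Vertex (head E e)" "Ghost e" m]
  by (simp add: corner_def Q.mult_closed range_ghost_class)

lemma edge_mult_other_corner:
  assumes "m \<in> corner v" "e \<in> arcs E" "v \<in> verts E" "head E e \<noteq> v"
  shows "gen (Edge e) \<otimes>\<^bsub>Q\<^esub> m = \<zero>\<^bsub>Q\<^esub>"
proof -
  have m: "m \<in> carrier Q"
    using assms(1) by (rule corner_carrier)
  have "gen (Edge e) \<otimes>\<^bsub>Q\<^esub> m = gen (Edge e) \<otimes>\<^bsub>Q\<^esub> (gen (Vertex (head E e)) \<otimes>\<^bsub>Q\<^esub> m)"
    using assms m by (simp add: gen_mult_assoc edge_range_class)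
  then show ?thesis
    using assms by (simp add: vertex_mult_corner)
qed

lemma ghost_mult_other_corner:
  assumes "m \<in> corner v" "e \<in> arcs E" "v \<in> verts E" "tail E e \<noteq> v"
  shows "gen (Ghost e) \<otimes>\<^bsub>Q\<^esub> m = \<zero>\<^bsub>Q\<^esub>"
proof -
  have m: "m \<in> carrier Q"
    using assms(1) by (rule corner_carrier)
  have "gen (Ghost e) \<otimes>\<^bsub>Q\<^esub> m = gen (Ghost e) \<otimes>\<^bsub>Q\<^esub> (gen (Vertex (tail E e)) \<otimes>\<^bsub>Q\<^esub> m)"
    using assms m by (simp add: gen_mult_assoc ghost_source_class)
  then show ?thesis
    using assms by (simp add: vertex_mult_corner)
qed

lemma ghost_edge_mult:
  assumes "e \<in> arcs E" "f \<in> arcs E" "m \<in> corner (head E f)"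
  shows "gen (Ghost e) \<otimes>\<^bsub>Q\<^esub> (gen (Edge f) \<otimes>\<^bsub>Q\<^esub> m) = (if e = f then m else \<zero>\<^bsub>Q\<^esub>)"
  using assms gen_mult_assoc[of "Ghost e" "Edge f" m]
  by (simp add: ghost_edge_class corner_def)

abbreviation "edges p \<equiv> map Edge p"
abbreviation "ghosts p \<equiv> map Ghost (rev p)"

lemma edges_gens: "awalk u p v \<Longrightarrow> gens (edges p)"
  and ghosts_gens: "awalk u p v \<Longrightarrow> gens (ghosts p)"
  by (auto simp: generators_def awalk_def)

lemma edges_corner: "\<lbrakk>awalk u p v; m \<in> corner v\<rbrakk> \<Longrightarrow> act (edges p) m \<in> corner u"
proof (induction p arbitrary: u)
  case Nil
  then show ?case by (simp add: awalk_Nil_iff)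
next
  case (Cons e p)
  then have e: "e \<in> arcs E" "u = tail E e" and "awalk (head E e) p v"
    by (auto simp: awalk_Cons_iff)
  then have "act (edges p) m \<in> corner (head E e)"
    using Cons by blast
  from edge_mult_corner[OF corner_carrier[OF this] e(1)] e(2) show ?case
    by simp
qed

lemma ghosts_corner: "\<lbrakk>awalk u p v; m \<in> corner u\<rbrakk> \<Longrightarrow> act (ghosts p) m \<in> corner v"
proof (induction p arbitrary: u m)
  case Nil
  then show ?case by (simp add: awalk_Nil_iff)
next
  case (Cons e p)
  then have e: "e \<in> arcs E" and p: "awalk (head E e) p v"
    by (auto simp: awalk_Cons_iff)
  have "gen (Ghost e) \<otimes>\<^bsub>Q\<^esub> m \<in> corner (head E e)"
    using ghost_mult_corner[OF corner_carrier[OF Cons.prems(2)] e] .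
  from Cons.IH[OF p this] show ?case
    by simp
qed

lemma ghosts_edges_cancel: "\<lbrakk>awalk u p v; m \<in> corner v\<rbrakk> \<Longrightarrow> act (ghosts p) (act (edges p) m) = m"
proof (induction p arbitrary: u)
  case Nil
  then show ?case by simp
next
  case (Cons e p)
  then have e: "e \<in> arcs E" and p: "awalk (head E e) p v"
    by (auto simp: awalk_Cons_iff)
  then have "act (edges p) m \<in> corner (head E e)"
    using Cons.prems edges_corner by blast
  with Cons.IH[OF p Cons.prems(2)] e show ?case
    by (simp add: ghost_edge_mult)
qed

text \<open>
  Cancel the longest common prefix of \<open>p\<close> and \<open>q\<close>; then a product \<open>b\<^sup>* c\<close> with distinct edges \<open>b\<close>
  and \<open>c\<close> is left.
\<close>

lemma ghosts_edges_parallel: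
  assumes p: "awalk u p v" and q: "awalk u q w" and "p \<parallel> q" and m: "m \<in> corner w"
  shows "act (ghosts p) (act (edges q) m) = \<zero>\<^bsub>Q\<^esub>"
proof -
  obtain a b bs c cs where split: "b \<noteq> c" "p = a @ b # bs" "q = a @ c # cs"
    using parallel_decomp[OF \<open>p \<parallel> q\<close>] by blast
  let ?x = "awlast u a"
  have a: "awalk u a ?x" and b: "awalk ?x (b # bs) v" and c: "awalk ?x (c # cs) w"
    using p q split by simp_all
  have arcs: "b \<in> arcs E" "c \<in> arcs E"
    using b c by (auto simp: awalk_Cons_iff)
  have "act (edges cs) m \<in> corner (head E c)"
    using c m edges_corner by (auto simp: awalk_Cons_iff)
  then have zero: "gen (Ghost b) \<otimes>\<^bsub>Q\<^esub> (gen (Edge c) \<otimes>\<^bsub>Q\<^esub> act (edges cs) m) = \<zero>\<^bsub>Q\<^esub>"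
    using arcs split(1) by (simp add: ghost_edge_mult)
  have "act (ghosts a) (act (edges a) (act (edges (c # cs)) m)) = act (edges (c # cs)) m"
    by (rule ghosts_edges_cancel[OF a edges_corner[OF c m]])
  moreover have "gens (ghosts bs)"
    using b ghosts_gens[of "head E b" bs v] by (auto simp: awalk_Cons_iff)
  ultimately show ?thesis
    using zero split by (simp add: act_zero)
qed

section \<open>Spanning by walks\<close>

lemma awalk_snoc:
  assumes "awalk u p (tail E e)" "e \<in> arcs E"
  shows "awalk u (p @ [e]) (head E e)"
  using assms by (intro awalk_appendI) (auto simp: awalk_Cons_iff awalk_Nil_iff)

text \<open>
  The reduction of words to \<open>p q\<^sup>*\<close>, letter by letter from the right. A vertex or an edge in front of
  \<open>p q\<^sup>*\<close> either fits the start of \<open>p\<close> or annihilates it; a ghost edge cancels the first edge of \<open>p\<close>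
  or annihilates it, and if \<open>p\<close> is empty it extends \<open>q\<close>.
\<close>

lemma act_normal_form:
  assumes "gens w" "v \<in> verts E" "m \<in> corner v"
  shows "act w m = \<zero>\<^bsub>Q\<^esub> \<or> (\<exists>u p q x. awalk u p x \<and> awalk v q x \<and>
    int (length p) - int (length q) = word_degree w \<and> act w m = act (edges p) (act (ghosts q) m))"
  using assms(1)
proof (induction w)
  case Nil
  have "awalk v [] v"
    using assms(2) by (simp add: awalk_Nil_iff)
  then have "awalk v [] v \<and> awalk v [] v \<and> int (length []) - int (length []) = word_degree [] \<and>
      act [] m = act (edges []) (act (ghosts []) m)"
    by (simp add: word_degree_def)
  then show ?case
    by blast
next
  case (Cons g w)
  then have g: "g \<in> generators E" and w: "gens w"
    by simp_all
  consider "act w m = \<zero>\<^bsub>Q\<^esub>" | u p q x where "awalk u p x" "awalk v q x"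
      "int (length p) - int (length q) = word_degree w" "act w m = act (edges p) (act (ghosts q) m)"
    using Cons.IH[OF w] by blast
  then show ?case
  proof cases
    case 1
    then show ?thesis
      using g by simp
  next
    case 2
    note p = 2(1) and q = 2(2) and deg = 2(3) and w_eq = 2(4)
    have gm: "act (ghosts q) m \<in> corner x"
      using q assms(3) by (rule ghosts_corner)
    have n: "act w m \<in> corner u"
      unfolding w_eq using p gm by (rule edges_corner)
    have u: "u \<in> verts E"
      using p by (rule awalk_hd_in_verts)
    consider y where "g = Vertex y" "y \<in> verts E"
      | e where "g = Edge e" "e \<in> arcs E" | e where "g = Ghost e" "e \<in> arcs E"
      using g by (auto simp: generators_def)
    then show ?thesis
    proof cases
      case (1 y)
      show ?thesis
      proof (cases "y = u")
        case True
        then have "act (g # w) m = act (edges p) (act (ghosts q) m)"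
          using 1 w_eq n by (simp add: corner_fixed)
        moreover have "word_degree (g # w) = word_degree w"
          using 1 by (simp add: word_degree_def)
        ultimately show ?thesis
          using p q deg by metis
      next
        case False
        then show ?thesis
          using 1 n u by (simp add: vertex_mult_corner)
      qed
    next
      case (2 e)
      show ?thesis
      proof (cases "head E e = u")
        case True
        then have "awalk (tail E e) (e # p) x"
          using 2 p by (auto simp: awalk_Cons_iff)
        moreover have "act (g # w) m = act (edges (e # p)) (act (ghosts q) m)"
          using 2 w_eq by simp
        moreover have "int (length (e # p)) - int (length q) = word_degree (g # w)"
          using 2 deg by (simp add: word_degree_def)
        ultimately show ?thesis
          using q by blast
      next
        case False
        then show ?thesis
          using 2 n u by (simp add: edge_mult_other_corner)
      qed
    next
      case (3 e)
      have deg_g: "word_degree (g # w) = word_degree w - 1"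
        using 3 by (simp add: word_degree_def)
      show ?thesis
      proof (cases "tail E e = u")
        case tail: True
        show ?thesis
        proof (cases p)
          case Nil
          then have x: "x = tail E e"
            using p tail by (simp add: awalk_Nil_iff)
          then have "awalk v (q @ [e]) (head E e)"
            using q 3 awalk_snoc by blast
          moreover have "awalk (head E e) [] (head E e)"
            using 3 by (simp add: awalk_Nil_iff)
          moreover have "act (g # w) m = act (edges []) (act (ghosts (q @ [e])) m)"
            using 3 w_eq Nil by simp
          moreover have "int (length []) - int (length (q @ [e])) = word_degree (g # w)"
            using deg deg_g Nil by simp
          ultimately show ?thesis
            by blast
        next
          case (Cons f p')
          then have f: "f \<in> arcs E" and p': "awalk (head E f) p' x"
            using p by (auto simp: awalk_Cons_iff)
          have corner: "act (edges p') (act (ghosts q) m) \<in> corner (head E f)"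
            using p' gm by (rule edges_corner)
          show ?thesis
          proof (cases "e = f")
            case True
            then have "act (g # w) m = act (edges p') (act (ghosts q) m)"
              using 3 w_eq Cons corner f by (simp add: ghost_edge_mult)
            moreover have "int (length p') - int (length q) = word_degree (g # w)"
              using deg deg_g Cons by simp
            ultimately show ?thesis
              using p' q by blast
          next
            case False
            then show ?thesis
              using 3 w_eq Cons corner f by (simp add: ghost_edge_mult)
          qed
        qed
      next
        case False
        then show ?thesis
          using 3 n u by (simp add: ghost_mult_other_corner)
      qed
    qed
  qed
qed

lemma vertex_class_corner:
  assumes "c \<in> carrier R" "v \<in> verts E"
  shows "mono_class c [Vertex v] \<in> corner v"
  using assms by (simp add: corner_def mono_class_mult vertex_vertex_class)

text \<open>
  A trailing edge or ghost edge absorbs a vertex on its right. This provides the vertex that carries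
  the coefficient.
\<close>

lemma mono_class_ends_with_vertex:
  assumes c: "c \<in> carrier R" and w: "w \<noteq> []" "gens w"
  obtains ws v where "gens ws" "v \<in> verts E" "word_degree ws = word_degree w"
    "mono_class c w = act ws (mono_class c [Vertex v])"
proof -
  obtain ws g where w_eq: "w = ws @ [g]"
    using w(1) by (cases w rule: rev_cases) auto
  then have ws: "gens ws" and g: "g \<in> generators E"
    using w(2) by simp_all
  have class_eq: "mono_class c w = act ws (mono_class c [g])"
    using ws g c by (simp add: w_eq act_mono_class)
  consider v where "g = Vertex v" "v \<in> verts E"
    | e where "g = Edge e" "e \<in> arcs E" | e where "g = Ghost e" "e \<in> arcs E"
    using g by (auto simp: generators_def)
  then show thesis
  proof cases
    case (1 v)
    then show thesis
      using that[of ws v] ws class_eq by (simp add: w_eq word_degree_def)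
  next
    case (2 e)
    then have "mono_class c [g] = gen g \<otimes>\<^bsub>Q\<^esub> mono_class c [Vertex (head E e)]"
      using c by (simp add: mono_class_mult edge_range_class)
    then have "mono_class c w = act w (mono_class c [Vertex (head E e)])"
      using class_eq by (simp add: w_eq)
    then show thesis
      using that[of w "head E e"] w(2) 2 by simp
  next
    case (3 e)
    then have "mono_class c [g] = gen g \<otimes>\<^bsub>Q\<^esub> mono_class c [Vertex (tail E e)]"
      using c by (simp add: mono_class_mult ghost_source_class)
    then have "mono_class c w = act w (mono_class c [Vertex (tail E e)])"
      using class_eq by (simp add: w_eq)
    then show thesis
      using that[of w "tail E e"] w(2) 3 by simp
  qed
qed

lemma component_spanned_by_walks:
  assumes H: "additive_subgroup H Q"
    and walks: "\<And>c u p v q x. \<lbrakk>c \<in> carrier R; awalk u p x; awalk v q x;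
        int (length p) - int (length q) = n\<rbrakk> \<Longrightarrow>
        act (edges p) (act (ghosts q) (mono_class c [Vertex v])) \<in> H"
    and m: "m \<in> leavitt_component R E n"
  shows "m \<in> H"
proof -
  interpret H: additive_subgroup H Q by (rule H)
  obtain a where a: "a \<in> homogeneous n" and m_eq: "m = I +>\<^bsub>F\<^esub> a"
    using m by (auto simp: leavitt_component_eq)
  let ?K = "{a \<in> carrier F. I +>\<^bsub>F\<^esub> a \<in> H}"
  have a': "a \<in> carrier F"
    using a by (rule homogeneous_carrier)
  have "additive_subgroup ?K F"
  proof (rule F.additive_subgroup_criterion)
    show "\<zero>\<^bsub>F\<^esub> \<in> ?K"
      using H.zero_closed I.a_rcos_const[OF I.zero_closed] by (simp add: I.quotient_zero)
    show "x \<oplus>\<^bsub>F\<^esub> y \<in> ?K" if "x \<in> ?K" "y \<in> ?K" for x y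
      using that H.a_closed[of "I +>\<^bsub>F\<^esub> x" "I +>\<^bsub>F\<^esub> y"] by (simp add: I.coset_add)
    show "\<ominus>\<^bsub>F\<^esub> x \<in> ?K" if "x \<in> ?K" for x
      using that H.a_inv_closed[of "I +>\<^bsub>F\<^esub> x"] by (simp add: I.coset_minus)
  qed auto
  then have "a \<in> ?K"
  proof (rule in_additive_subgroup_if_monomials[OF _ a'])
    fix w assume "a w \<noteq> \<zero>"
    then have w: "w \<noteq> []" "gens w" "word_degree w = n" and c: "a w \<in> carrier R"
      using a' supportD[OF a'] homogeneousD[OF a] by auto
    obtain ws v where ws: "gens ws" "v \<in> verts E" "word_degree ws = n"
        "mono_class (a w) w = act ws (mono_class (a w) [Vertex v])"
      using mono_class_ends_with_vertex[OF c w(1,2)] w(3) by metis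
    have "mono_class (a w) w \<in> H"
      using act_normal_form[OF ws(1,2) vertex_class_corner[OF c ws(2)]] walks[OF c] ws(3,4) H.zero_closed
      by metis
    then show "monomial (a w) w \<in> ?K"
      using c w by (simp add: mono_class_def monomial_closed)
  qed
  then show ?thesis
    by (simp add: m_eq)
qed


section \<open>Local units from minimal walks\<close>

text \<open>The idempotent \<open>p p\<^sup>*\<close>.\<close>

definition range_projection :: "'v \<times> 'e list \<Rightarrow> (('v, 'e) generator list \<Rightarrow> 'a) set" where
  "range_projection = (\<lambda>(u, p). act (edges p) (act (ghosts p) (gen (Vertex u))))"

lemma range_projection_corner:
  assumes "awalk u p x"
  shows "range_projection (u, p) \<in> corner u"
  using assms vertex_class_corner[of \<one> u] awalk_hd_in_verts
  by (auto simp: range_projection_def intro!: edges_corner ghosts_corner)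

lemma range_projection_mult:
  assumes p: "awalk u p x" and m: "m \<in> corner v" and v: "v \<in> verts E"
  shows "range_projection (u, p) \<otimes>\<^bsub>Q\<^esub> m =
    (if u = v then act (edges p) (act (ghosts p) m) else \<zero>\<^bsub>Q\<^esub>)"
proof -
  have u: "u \<in> verts E"
    using p by (rule awalk_hd_in_verts)
  have "range_projection (u, p) \<otimes>\<^bsub>Q\<^esub> m = act (edges p) (act (ghosts p) (gen (Vertex u) \<otimes>\<^bsub>Q\<^esub> m))"
    using corner_carrier[OF m] u edges_gens[OF p] ghosts_gens[OF p]
    by (simp add: range_projection_def act_mult)
  then show ?thesis
    using m u v edges_gens[OF p] ghosts_gens[OF p]
    by (simp add: vertex_mult_corner act_zero)
qed

text \<open>
  The coefficient ring may be noncommutative, but the coefficients of \<open>p p\<^sup>*\<close> are \<open>1\<close>. So \<open>p p\<^sup>*\<close>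
  commutes with multiples of vertices, and right multiplication is reduced to left multiplication.
\<close>

lemma mult_range_projection:
  assumes p: "awalk u p x" and c: "c \<in> carrier R" and v: "v \<in> verts E"
  shows "mono_class c [Vertex v] \<otimes>\<^bsub>Q\<^esub> range_projection (u, p) =
    range_projection (u, p) \<otimes>\<^bsub>Q\<^esub> mono_class c [Vertex v]"
proof -
  have u: "u \<in> verts E"
    using p by (rule awalk_hd_in_verts)
  note gens = edges_gens[OF p] ghosts_gens[OF p]
  have "mono_class c [Vertex v] \<otimes>\<^bsub>Q\<^esub> range_projection (u, p) =
      mono_class c ([Vertex v] @ edges p @ ghosts p @ [Vertex u])"
    using u v c gens by (simp add: range_projection_def act_mono_class mono_class_mult)
  also have "\<dots> = act ([Vertex v] @ edges p @ ghosts p) (mono_class c [Vertex u])"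
    using u v c gens by (subst act_mono_class) auto
  also have "\<dots> = gen (Vertex v) \<otimes>\<^bsub>Q\<^esub> act (edges p) (act (ghosts p) (mono_class c [Vertex u]))"
    by simp
  also have "\<dots> = (if v = u then act (edges p) (act (ghosts p) (mono_class c [Vertex u])) else \<zero>\<^bsub>Q\<^esub>)"
    using edges_corner[OF p ghosts_corner[OF p vertex_class_corner[OF c u]]] v u
    by (rule vertex_mult_corner)
  also have "\<dots> = range_projection (u, p) \<otimes>\<^bsub>Q\<^esub> mono_class c [Vertex v]"
    using range_projection_mult[OF p vertex_class_corner[OF c v] v] by auto
  finally show ?thesis .
qed

definition epsilon :: "int \<Rightarrow> (('v, 'e) generator list \<Rightarrow> 'a) set" where
  "epsilon n = finsum Q range_projection (minimal_walks n)"

lemma minimal_walks_awalk: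
  assumes "(u, p) \<in> minimal_walks n"
  obtains x where "awalk u p x"
  using assms by (auto simp: minimal_walks_def leading_walks_def)

lemma range_projection_closed: "range_projection \<in> minimal_walks n \<rightarrow> carrier Q"
  using range_projection_corner corner_carrier minimal_walks_awalk by (metis Pi_I surj_pair)

lemma epsilon_closed: "epsilon n \<in> carrier Q"
  unfolding epsilon_def by (rule Q.finsum_closed[OF range_projection_closed])

text \<open>
  Among the summands of \<open>\<epsilon>\<^sub>n\<close> only the one of the minimal prefix of \<open>p\<close> survives the multiplication
  with \<open>p\<close>, and it fixes \<open>p\<close>.
\<close>

lemma epsilon_mult_walk:
  assumes up: "(u, p) \<in> leading_walks n" and p: "awalk u p x" and m: "m \<in> corner x"
  shows "epsilon n \<otimes>\<^bsub>Q\<^esub> act (edges p) m = act (edges p) m"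
proof -
  obtain p0 p' where p0: "(u, p0) \<in> minimal_walks n" "p = p0 @ p'"
      and others: "\<And>p1. \<lbrakk>(u, p1) \<in> minimal_walks n; p1 \<noteq> p0\<rbrakk> \<Longrightarrow> p1 \<parallel> p"
    using minimal_walk_prefix[OF up] by metis
  have u: "u \<in> verts E"
    using p by (rule awalk_hd_in_verts)
  have walk: "awalk u p0 (awlast u p0)" and walk': "awalk (awlast u p0) p' x"
    using p p0 by simp_all
  let ?m = "act (edges p) m"
  have pm: "?m \<in> corner u"
    using p m by (rule edges_corner)
  have "range_projection (u, p0) \<otimes>\<^bsub>Q\<^esub> ?m = ?m"
    using range_projection_mult[OF walk pm u] ghosts_edges_cancel[OF walk edges_corner[OF walk' m]] p0(2)
    by simp
  moreover have "range_projection b \<otimes>\<^bsub>Q\<^esub> ?m = \<zero>\<^bsub>Q\<^esub>" if b: "b \<in> minimal_walks n" "b \<noteq> (u, p0)" for b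
  proof -
    obtain u1 p1 x1 where b_eq: "b = (u1, p1)" and p1: "awalk u1 p1 x1"
      using b(1) minimal_walks_awalk by (metis surj_pair)
    show ?thesis
    proof (cases "u1 = u")
      case True
      then have "p1 \<parallel> p"
        using b b_eq others by auto
      then have "act (ghosts p1) ?m = \<zero>\<^bsub>Q\<^esub>"
        using p1 p True m ghosts_edges_parallel by blast
      then show ?thesis
        using range_projection_mult[OF p1 pm u] b_eq edges_gens[OF p1]
        by (simp add: act_zero)
    next
      case False
      then show ?thesis
        using range_projection_mult[OF p1 pm u] b_eq by simp
    qed
  qed
  ultimately show ?thesis
    using Q.finsum_one_nonzero[OF finite_minimal_walks p0(1), of "\<lambda>b. range_projection b \<otimes>\<^bsub>Q\<^esub> ?m"]
      corner_carrier[OF pm]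
    by (simp add: epsilon_def Q.finsum_mult[OF range_projection_closed])
qed

text \<open>
  The mirror image of the preceding lemma. Moving \<open>\<epsilon>\<^sub>n\<close> past the coefficient at the right end makes
  the factors \<open>p\<^sup>* p\<^sub>1\<close> meet, where \<open>p\<^sub>1\<close> runs through the minimal walks.
\<close>

lemma walk_mult_epsilon:
  assumes up: "(u, p) \<in> leading_walks n" and p: "awalk u p x" and c: "c \<in> carrier R"
  shows "act (ghosts p) (mono_class c [Vertex u]) \<otimes>\<^bsub>Q\<^esub> epsilon n = act (ghosts p) (mono_class c [Vertex u])"
proof -
  obtain p0 p' where p0: "(u, p0) \<in> minimal_walks n" "p = p0 @ p'"
      and others: "\<And>p1. \<lbrakk>(u, p1) \<in> minimal_walks n; p1 \<noteq> p0\<rbrakk> \<Longrightarrow> p1 \<parallel> p"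
    using minimal_walk_prefix[OF up] by metis
  have u: "u \<in> verts E"
    using p by (rule awalk_hd_in_verts)
  have walk: "awalk u p0 (awlast u p0)" and walk': "awalk (awlast u p0) p' x"
    using p p0 by simp_all
  let ?c = "mono_class c [Vertex u]"
  have cm: "?c \<in> corner u"
    using c u by (rule vertex_class_corner)
  let ?f = "\<lambda>b. act (ghosts p) (?c \<otimes>\<^bsub>Q\<^esub> range_projection b)"
  have proj: "?c \<otimes>\<^bsub>Q\<^esub> range_projection (u1, p1) =
      (if u1 = u then act (edges p1) (act (ghosts p1) ?c) else \<zero>\<^bsub>Q\<^esub>)" if "awalk u1 p1 x1" for u1 p1 x1
    using mult_range_projection[OF that c u] range_projection_mult[OF that cm u] by simp
  have "?f (u, p0) = act (ghosts p) ?c"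
    using proj[OF walk] ghosts_edges_cancel[OF walk ghosts_corner[OF walk cm]] p0(2) by simp
  moreover have "?f b = \<zero>\<^bsub>Q\<^esub>" if b: "b \<in> minimal_walks n" "b \<noteq> (u, p0)" for b
  proof -
    obtain u1 p1 x1 where b_eq: "b = (u1, p1)" and p1: "awalk u1 p1 x1"
      using b(1) minimal_walks_awalk by (metis surj_pair)
    show ?thesis
    proof (cases "u1 = u")
      case True
      then have "p \<parallel> p1"
        using b b_eq others by (auto intro: parallelI elim: parallelE)
      then show ?thesis
        using proj[OF p1] b_eq True p1 p ghosts_corner[OF p1] cm ghosts_edges_parallel by simp
    next
      case False
      then show ?thesis
        using proj[OF p1] b_eq ghosts_gens[OF p] by (simp add: act_zero)
    qed
  qed
  ultimately have sum: "finsum Q ?f (minimal_walks n) = act (ghosts p) ?c"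
    using Q.finsum_one_nonzero[OF finite_minimal_walks p0(1), of ?f]
      corner_carrier[OF ghosts_corner[OF p cm]] by simp
  have pc: "act (ghosts p) ?c \<in> carrier Q"
    using ghosts_corner[OF p cm] by (rule corner_carrier)
  have f_closed: "?f \<in> minimal_walks n \<rightarrow> carrier Q"
    using range_projection_closed[of n] ghosts_gens[OF p] corner_carrier[OF cm]
    by (intro Pi_I act_closed Q.mult_closed) auto
  have "act (ghosts p) ?c \<otimes>\<^bsub>Q\<^esub> range_projection b = ?f b" if "b \<in> minimal_walks n" for b
    using that range_projection_closed[of n] ghosts_gens[OF p] corner_carrier[OF cm]
    by (intro act_mult) auto
  then have "act (ghosts p) ?c \<otimes>\<^bsub>Q\<^esub> epsilon n = finsum Q ?f (minimal_walks n)"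
    unfolding epsilon_def Q.mult_finsum[OF range_projection_closed pc]
    by (intro Q.finsum_cong' refl f_closed)
  with sum show ?thesis
    by simp
qed

text \<open>
  If \<open>p q\<^sup>*\<close> has degree \<open>n\<close> then \<open>q p\<^sup>*\<close> has degree \<open>- n\<close>, and \<open>q\<^sup>* q\<close> is the common end vertex,
  so \<open>p p\<^sup>* = (p q\<^sup>*) (q p\<^sup>*)\<close>.
\<close>

lemma epsilon_in_ideal_prod:
  "epsilon n \<in> ideal_prod Q (leavitt_component R E n) (leavitt_component R E (- n))"
  unfolding epsilon_def
proof (rule Q.finsum_in_additive_subgroup)
  show "additive_subgroup (ideal_prod Q (leavitt_component R E n) (leavitt_component R E (- n))) Q"
    by (intro Q.ideal_prod_additive_subgroup L.component_subgroup) simp_all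
  show "range_projection \<in> minimal_walks n \<rightarrow> ideal_prod Q (leavitt_component R E n) (leavitt_component R E (- n))"
  proof
    fix b assume "b \<in> minimal_walks n"
    moreover obtain u p where b: "b = (u, p)"
      by (cases b)
    ultimately have "(u, p) \<in> leading_walks n"
      using minimal_walks_subset by blast
    then obtain x w q where p: "awalk u p x" and q: "awalk w q x"
        and len: "int (length p) - int (length q) = n"
      by (auto simp: leading_walks_def)
    have verts: "u \<in> verts E" "w \<in> verts E"
      using p q awalk_hd_in_verts by blast+
    note gens = edges_gens[OF p] ghosts_gens[OF p] edges_gens[OF q] ghosts_gens[OF q]
    have degree: "word_degree (edges r @ ghosts s @ [Vertex y]) = int (length r) - int (length s)"
      for r s :: "'e list" and y :: 'v
      by (simp add: word_degree_def comp_def sum_list_triv)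
    let ?a = "act (edges p) (act (ghosts q) (gen (Vertex w)))"
    let ?b = "act (edges q) (act (ghosts p) (gen (Vertex u)))"
    have "?a = mono_class \<one> (edges p @ ghosts q @ [Vertex w])"
      using verts gens by (simp add: act_mono_class)
    also have "\<dots> \<in> leavitt_component R E n"
      using verts gens len by (intro mono_class_component) (auto simp: degree)
    finally have a: "?a \<in> leavitt_component R E n" .
    have "?b = mono_class \<one> (edges q @ ghosts p @ [Vertex u])"
      using verts gens by (simp add: act_mono_class)
    also have "\<dots> \<in> leavitt_component R E (- n)"
      using verts gens len by (intro mono_class_component) (auto simp: degree)
    finally have b': "?b \<in> leavitt_component R E (- n)" .
    have pu: "act (ghosts p) (gen (Vertex u)) \<in> corner x"
      by (rule ghosts_corner[OF p vertex_class_corner[OF one_closed verts(1)]])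
    have "?b \<in> corner w"
      using q pu by (rule edges_corner)
    then have "?a \<otimes>\<^bsub>Q\<^esub> ?b = act (edges p) (act (ghosts q) ?b)"
      using gens verts by (simp add: act_mult corner_carrier corner_fixed)
    also have "\<dots> = range_projection b"
      using ghosts_edges_cancel[OF q pu] by (simp add: b range_projection_def)
    finally show "range_projection b \<in> ideal_prod Q (leavitt_component R E n) (leavitt_component R E (- n))"
      using ideal_prod.prod[OF a b', of Q] by simp
  qed
qed

lemma epsilon_left_unit:
  assumes "m \<in> leavitt_component R E n"
  shows "epsilon n \<otimes>\<^bsub>Q\<^esub> m = m"
proof -
  have "m \<in> {m \<in> carrier Q. epsilon n \<otimes>\<^bsub>Q\<^esub> m = m}"
  proof (rule component_spanned_by_walks[OF Q.additive_subgroup_criterion _ assms])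
    fix c u p v q x
    assume "c \<in> carrier R" and p: "awalk u p x" and q: "awalk v q x"
      and "int (length p) - int (length q) = n"
    then have "(u, p) \<in> leading_walks n" and corner: "act (ghosts q) (mono_class c [Vertex v]) \<in> corner x"
      using awalk_hd_in_verts[OF q] by (auto simp: leading_walks_def intro: ghosts_corner vertex_class_corner)
    then show "act (edges p) (act (ghosts q) (mono_class c [Vertex v])) \<in> {m \<in> carrier Q. epsilon n \<otimes>\<^bsub>Q\<^esub> m = m}"
      using epsilon_mult_walk[OF _ p] corner_carrier[OF edges_corner[OF p]] by simp
  qed (auto simp: epsilon_closed Q.mult_distr_left Q.mult_minus)
  then show ?thesis by simp
qed

lemma epsilon_right_unit:
  assumes "m \<in> leavitt_component R E n"
  shows "m \<otimes>\<^bsub>Q\<^esub> epsilon (- n) = m"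
proof -
  have "m \<in> {m \<in> carrier Q. m \<otimes>\<^bsub>Q\<^esub> epsilon (- n) = m}"
  proof (rule component_spanned_by_walks[OF Q.additive_subgroup_criterion _ assms])
    fix c u p v q x
    assume c: "c \<in> carrier R" and p: "awalk u p x" and q: "awalk v q x"
      and "int (length p) - int (length q) = n"
    then have "int (length q) - int (length p) = - n"
      by simp
    with p q have "(v, q) \<in> leading_walks (- n)"
      unfolding leading_walks_def by blast
    moreover have "act (ghosts q) (mono_class c [Vertex v]) \<in> corner x"
      using ghosts_corner[OF q vertex_class_corner[OF c awalk_hd_in_verts[OF q]]] .
    ultimately show "act (edges p) (act (ghosts q) (mono_class c [Vertex v])) \<in> {m \<in> carrier Q. m \<otimes>\<^bsub>Q\<^esub> epsilon (- n) = m}"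
      using walk_mult_epsilon[OF _ q c] corner_carrier[OF edges_corner[OF p]] edges_gens[OF p]
      by (simp add: act_mult epsilon_closed corner_carrier)
  qed (auto simp: epsilon_closed Q.mult_distr_right Q.minus_mult)
  then show ?thesis by simp
qed

lemma leavitt_epsilon_strongly_graded:
  "epsilon_strongly_graded_ring integer_group (leavitt_path_algebra R E) (leavitt_component R E)"
  unfolding leavitt_path_algebra_eq
proof (rule L.epsilon_strongly_gradedI)
  fix n :: int
  have inv: "inv\<^bsub>integer_group\<^esub> n = - n"
    by simp
  show "\<exists>t\<in>ideal_prod Q (leavitt_component R E n) (leavitt_component R E (inv\<^bsub>integer_group\<^esub> n)).
      \<forall>m\<in>leavitt_component R E n. t \<otimes>\<^bsub>Q\<^esub> m = m"
    unfolding inv using epsilon_in_ideal_prod epsilon_left_unit by blast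
  show "\<exists>t\<in>ideal_prod Q (leavitt_component R E (inv\<^bsub>integer_group\<^esub> n)) (leavitt_component R E n).
      \<forall>m\<in>leavitt_component R E n. m \<otimes>\<^bsub>Q\<^esub> t = m"
    unfolding inv using epsilon_in_ideal_prod[of "- n"] epsilon_right_unit
    by (intro bexI[of _ "epsilon (- n)"]) simp_all
qed

end

theorem theorem2:
  fixes R :: "('r, 'm) ring_scheme" and E :: "('v, 'e) pre_digraph"
  assumes "ring R" and "fin_digraph E"
  shows "epsilon_strongly_graded_ring integer_group
           (leavitt_path_algebra R E) (leavitt_component R E)"
proof -
  interpret leavitt R E
    using assms by (rule leavitt.intro)
  show ?thesis
    by (rule leavitt_epsilon_strongly_graded)
qed

end
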